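(* Let $D$ be a Dedekind domain that is not a field, let $M$ be a finitely generated $D$-module, and put $T=\tau(M)$ and $r=\operatorname{rank}_D M$. (i) If $r\le 1$, every C4 defect of $T$ lifts explicitly to a C4 defect of $M$, and every C4 defect of $M$ reduces explicitly to a C4 defect of $T$. (ii) If $r\ge 2$, then $M$ has a C4 defect whose domain is free of rank one and whose image is a nonzero proper principal submodule of an invertible ideal summand of $M/T$. Consequently, $$\operatorname{Def}_{\mathrm{C4}}(M)=\varnothing\iff r\le 1\text{ and }\operatorname{Def}_{\mathrm{C4}}(T)=\varnothing.$$
   Context: For a module $M$ over a domain $D$, $\tau(M)=\{x\in M: xd=0\text{ for some }0\ne d\in D\}$ is the torsion submodule, and $\operatorname{rank}_D M=\dim_K(K\otimes_D M)$, where $K$ is the fraction field of $D$. If $D$ is Dedekind and $M$ is finitely generated, then $M/\tau(M)$ is finitely generated projective, so $M\cong P\oplus\tau(M)$ with $P$ finitely generated projective. A C4 defect of a module $X$ is a triple $(A,B,f)$ such that $X=A\oplus B$, $f:A\to B$ is a homomorphism, $\ker f$ is a direct summand of $A$, and $\operatorname{Im} f$ is not a direct summand of $B$; the domain and image of the defect are $A$ and $\operatorname{Im} f$. $\operatorname{Def}_{\mathrm{C4}}(X)$ denotes the class of all C4 defects of $X$. A module $X$ is called a C4-module if, whenever $X=A\oplus B$ and $f:A\to B$ is a homomorphism with $\ker f$ a direct summand of $A$, $\operatorname{Im} f$ is a direct summand of $B$; thus $X$ is a C4-module exactly when $\operatorname{Def}_{\mathrm{C4}}(X)=\varnothing$.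 *)

theory Defs
  imports
    "HOL-Computational_Algebra.Polynomial_Factorial"
    "HOL-Library.Poly_Mapping"
    "HOL-Library.FuncSet"
begin

text \<open>
  A commutative domain \<open>D\<close> is a type \<open>'a\<close> of class \<^class>\<open>idom\<close>; a \<open>D\<close>-module is a type \<open>'b\<close> with
  a scalar multiplication \<open>s\<close> satisfying the locale \<^locale>\<open>module\<close>. Submodules, in particular the
  ideals of \<open>D\<close> (where \<open>s\<close> is multiplication), are given by \<^const>\<open>module.subspace\<close>.
\<close>

section \<open>Dedekind domains and invertible ideals\<close>

abbreviation is_ideal :: "'a::idom set \<Rightarrow> bool" where
  "is_ideal I \<equiv> module.subspace (*) I"

definition noetherian_domain :: "'a::idom itself \<Rightarrow> bool" where
  "noetherian_domain _ \<longleftrightarrow>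
     (\<forall>I::'a set. is_ideal I \<longrightarrow> (\<exists>S. finite S \<and> I = module.span (*) S))"

definition prime_ideal :: "'a::idom set \<Rightarrow> bool" where
  "prime_ideal I \<longleftrightarrow> is_ideal I \<and> I \<noteq> UNIV \<and> (\<forall>a b. a * b \<in> I \<longrightarrow> a \<in> I \<or> b \<in> I)"

definition maximal_ideal :: "'a::idom set \<Rightarrow> bool" where
  "maximal_ideal I \<longleftrightarrow> is_ideal I \<and> I \<noteq> UNIV \<and> (\<forall>J. is_ideal J \<and> I \<subseteq> J \<longrightarrow> J = I \<or> J = UNIV)"

definition integrally_closed :: "'a::idom itself \<Rightarrow> bool" where
  "integrally_closed _ \<longleftrightarrow>
     (\<forall>x::'a fract. (\<exists>p::'a poly. lead_coeff p = 1 \<and> poly (fract_poly p) x = 0)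
        \<longrightarrow> x \<in> range to_fract)"

text \<open>With this definition a field is a Dedekind domain.\<close>

definition dedekind_domain :: "'a::idom itself \<Rightarrow> bool" where
  "dedekind_domain T \<longleftrightarrow>
     noetherian_domain T \<and> integrally_closed T \<and>
     (\<forall>I::'a set. prime_ideal I \<and> I \<noteq> {0} \<longrightarrow> maximal_ideal I)"

definition is_field :: "'a::idom itself \<Rightarrow> bool" where
  "is_field _ \<longleftrightarrow> (\<forall>d::'a. d \<noteq> 0 \<longrightarrow> (\<exists>e. d * e = 1))"

text \<open>The inverse of \<open>I\<close> consists of the \<open>y\<close> in the fraction field with \<open>y I \<subseteq> D\<close>. The ideal is
  invertible if the \<open>D\<close>-submodule generated by the products with elements of \<open>I\<close> is \<open>D\<close>.\<close>

definition inverse_ideal :: "'a::idom set \<Rightarrow> 'a fract set" where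
  "inverse_ideal I = {y. \<forall>a\<in>I. to_fract a * y \<in> range to_fract}"

definition invertible_ideal :: "'a::idom set \<Rightarrow> bool" where
  "invertible_ideal I \<longleftrightarrow> is_ideal I \<and>
     module.span (\<lambda>d y. to_fract d * y) {to_fract a * y |a y. a \<in> I \<and> y \<in> inverse_ideal I}
       = range to_fract"

section \<open>Submodules, torsion, direct sums, homomorphisms\<close>

definition finitely_generated :: "('a::idom \<Rightarrow> 'b::ab_group_add \<Rightarrow> 'b) \<Rightarrow> bool" where
  "finitely_generated s \<longleftrightarrow> (\<exists>S. finite S \<and> module.span s S = UNIV)"

definition torsion :: "('a::idom \<Rightarrow> 'b::ab_group_add \<Rightarrow> 'b) \<Rightarrow> 'b set \<Rightarrow> 'b set" where
  "torsion s X = {x \<in> X. \<exists>d. d \<noteq> 0 \<and> s d x = 0}"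

definition sum_sets :: "'b::ab_group_add set \<Rightarrow> 'b set \<Rightarrow> 'b set" where
  "sum_sets A B = {a + b |a b. a \<in> A \<and> b \<in> B}"

definition direct_sum ::
  "('a::idom \<Rightarrow> 'b::ab_group_add \<Rightarrow> 'b) \<Rightarrow> 'b set \<Rightarrow> 'b set \<Rightarrow> 'b set \<Rightarrow> bool" where
  "direct_sum s X A B \<longleftrightarrow>
     module.subspace s A \<and> module.subspace s B \<and> X = sum_sets A B \<and> A \<inter> B = {0}"

definition direct_summand ::
  "('a::idom \<Rightarrow> 'b::ab_group_add \<Rightarrow> 'b) \<Rightarrow> 'b set \<Rightarrow> 'b set \<Rightarrow> bool" where
  "direct_summand s N X \<longleftrightarrow> (\<exists>C. direct_sum s X N C)"

text \<open>For \<open>W \<subseteq> L \<subseteq> X\<close>: \<open>L/W\<close> is a direct summand of \<open>X/W\<close>. The submodules of \<open>X/W\<close> are the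
  \<open>C/W\<close> with \<open>W \<subseteq> C \<subseteq> X\<close>, and \<open>L/W + C/W = (L + C)/W\<close>, \<open>L/W \<inter> C/W = (L \<inter> C)/W\<close>.\<close>

definition quotient_direct_summand ::
  "('a::idom \<Rightarrow> 'b::ab_group_add \<Rightarrow> 'b) \<Rightarrow> 'b set \<Rightarrow> 'b set \<Rightarrow> 'b set \<Rightarrow> bool" where
  "quotient_direct_summand s W L X \<longleftrightarrow>
     module.subspace s L \<and> W \<subseteq> L \<and>
     (\<exists>C. module.subspace s C \<and> W \<subseteq> C \<and> X = sum_sets L C \<and> L \<inter> C = W)"

text \<open>Homomorphisms between submodules are functions that are \<^const>\<open>undefined\<close> outside their
  domain, so that they are determined by their values on it.\<close>

definition hom_set ::
  "('a::idom \<Rightarrow> 'b::ab_group_add \<Rightarrow> 'b) \<Rightarrow> ('a \<Rightarrow> 'c::ab_group_add \<Rightarrow> 'c) \<Rightarrow>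
     'b set \<Rightarrow> 'c set \<Rightarrow> ('b \<Rightarrow> 'c) set" where
  "hom_set s t A B =
     {f \<in> A \<rightarrow>\<^sub>E B. (\<forall>x\<in>A. \<forall>y\<in>A. f (x + y) = f x + f y) \<and> (\<forall>d. \<forall>x\<in>A. f (s d x) = t d (f x))}"

definition isomorphic ::
  "('a::idom \<Rightarrow> 'b::ab_group_add \<Rightarrow> 'b) \<Rightarrow> ('a \<Rightarrow> 'c::ab_group_add \<Rightarrow> 'c) \<Rightarrow>
     'b set \<Rightarrow> 'c set \<Rightarrow> bool" where
  "isomorphic s t A B \<longleftrightarrow> (\<exists>f \<in> hom_set s t A B. bij_betw f A B)"

definition free_of_rank_one ::
  "('a::idom \<Rightarrow> 'b::ab_group_add \<Rightarrow> 'b) \<Rightarrow> 'b set \<Rightarrow> bool" where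
  "free_of_rank_one s A \<longleftrightarrow> (\<exists>e. \<not> module.dependent s {e} \<and> A = module.span s {e})"

section \<open>Rank\<close>

text \<open>
  \<open>K \<otimes>\<^sub>D M\<close>, with \<open>K\<close> the fraction field, is the \<open>K\<close>-vector space generated by symbols
  \<open>1 \<otimes> x\<close> for \<open>x\<close> in \<open>M\<close>, subject to additivity in \<open>x\<close> and \<open>1 \<otimes> d x = d (1 \<otimes> x)\<close> for \<open>d\<close> in \<open>D\<close>.
  The free \<open>K\<close>-vector space on these symbols is the type \<open>'b \<Rightarrow>\<^sub>0 'a fract\<close>.
\<close>

definition free_scale :: "'k::field \<Rightarrow> ('b \<Rightarrow>\<^sub>0 'k) \<Rightarrow> ('b \<Rightarrow>\<^sub>0 'k)" where
  "free_scale c v = Poly_Mapping.map ((*) c) v"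

lemma lookup_free_scale: "Poly_Mapping.lookup (free_scale c v) x = c * Poly_Mapping.lookup v x"
  by (simp add: free_scale_def Poly_Mapping.map.rep_eq when_def)

lemma vector_space_free_scale: "vector_space (free_scale :: 'k::field \<Rightarrow> ('b \<Rightarrow>\<^sub>0 'k) \<Rightarrow> _)"
  by unfold_locales
     (simp_all add: poly_mapping_eq_iff fun_eq_iff lookup_add lookup_free_scale algebra_simps)

definition tensor_relations ::
  "('a::idom \<Rightarrow> 'b::ab_group_add \<Rightarrow> 'b) \<Rightarrow> ('b \<Rightarrow>\<^sub>0 'a fract) set" where
  "tensor_relations s = module.span free_scale
     ({Poly_Mapping.single (x + y) 1 - (Poly_Mapping.single x 1 + Poly_Mapping.single y 1) |x y. True}
      \<union> {Poly_Mapping.single (s d x) 1 - free_scale (to_fract d) (Poly_Mapping.single x 1) |d x. True})"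

text \<open>The cosets of the elements of \<open>B\<close> are pairwise distinct and form a basis of the quotient of
  the whole space by \<open>W\<close>.\<close>

definition quotient_basis ::
  "('k::field \<Rightarrow> 'v::ab_group_add \<Rightarrow> 'v) \<Rightarrow> 'v set \<Rightarrow> 'v set \<Rightarrow> bool" where
  "quotient_basis s W B \<longleftrightarrow>
     (\<forall>S c. finite S \<and> S \<subseteq> B \<and> (\<Sum>b\<in>S. s (c b) b) \<in> W \<longrightarrow> (\<forall>b\<in>S. c b = 0)) \<and>
     module.span s (W \<union> B) = UNIV"

text \<open>As for \<^const>\<open>vector_space.dim\<close>, the value is 0 in infinite dimension.\<close>

definition quotient_dim ::
  "('k::field \<Rightarrow> 'v::ab_group_add \<Rightarrow> 'v) \<Rightarrow> 'v set \<Rightarrow> nat" where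
  "quotient_dim s W = card (SOME B. quotient_basis s W B)"

definition module_rank :: "('a::idom \<Rightarrow> 'b::ab_group_add \<Rightarrow> 'b) \<Rightarrow> nat" where
  "module_rank s = quotient_dim free_scale (tensor_relations s)"

section \<open>C4 defects\<close>

type_synonym 'b defect = "'b set \<times> 'b set \<times> ('b \<Rightarrow> 'b)"

definition C4_defects ::
  "('a::idom \<Rightarrow> 'b::ab_group_add \<Rightarrow> 'b) \<Rightarrow> 'b set \<Rightarrow> 'b defect set" where
  "C4_defects s X = {(A, B, f).
     direct_sum s X A B \<and> f \<in> hom_set s s A B \<and>
     direct_summand s {x \<in> A. f x = 0} A \<and> \<not> direct_summand s (f ` A) B}"

text \<open>The reduction of a defect to the torsion submodule, and the two ways of lifting a defect
  \<open>(A, B, f)\<close> of the torsion submodule along a complement \<open>P\<close> of it: \<open>(P \<oplus> A, B, p + a \<mapsto> f a)\<close> and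
  \<open>(A, P \<oplus> B, f)\<close>.\<close>

definition reduce_defect ::
  "('a::idom \<Rightarrow> 'b::ab_group_add \<Rightarrow> 'b) \<Rightarrow> 'b defect \<Rightarrow> 'b defect" where
  "reduce_defect s = (\<lambda>(A, B, f). (torsion s A, torsion s B, restrict f (torsion s A)))"

definition lift_defect_domain :: "'b::ab_group_add set \<Rightarrow> 'b defect \<Rightarrow> 'b defect" where
  "lift_defect_domain P = (\<lambda>(A, B, f).
     (sum_sets P A, B, \<lambda>x \<in> sum_sets P A. f (THE a. a \<in> A \<and> x - a \<in> P)))"

definition lift_defect_codomain :: "'b::ab_group_add set \<Rightarrow> 'b defect \<Rightarrow> 'b defect" where
  "lift_defect_codomain P = (\<lambda>(A, B, f). (A, sum_sets P B, f))"

end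

theory Submission
  imports Defs
begin

text \<open>
  A finitely generated module over a domain has enough linear functionals to detect every nontorsion
  element. Over a Dedekind domain ideals are invertible, so a functional restricted to any submodule
  splits; splitting off finitely many functionals gives \<open>M = P \<oplus> T\<close>. With such a complement, defects of
  \<open>T\<close> extend to \<open>M\<close> by adding \<open>P\<close> to the domain or the codomain. In rank at most one a
  complement of \<open>ker f\<close> in \<open>A\<close> is torsion, as \<open>c\<close> and \<open>f c\<close> are independent for nontorsion \<open>c\<close> in it,
  so a defect of \<open>M\<close> keeps its image under restriction to torsion.

  In rank at least two, \<open>M\<close> has a functional \<open>\<psi>\<close> with \<open>\<psi> e = 1\<close> for some \<open>e\<close>: modify a functional
  on the kernel of another one by an approximation argument. Then \<open>M = D e \<oplus> ker \<psi>\<close>, the kernel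
  contains a summand \<open>J\<close> isomorphic to an invertible ideal, and \<open>e \<mapsto> q w\<close> with \<open>0 \<noteq> w \<in> J\<close> and \<open>q\<close> a
  nonzero nonunit is a defect.
\<close>

section \<open>Ideals of Dedekind domains\<close>

text \<open>Dedekind domains are given as integrally closed Noetherian domains whose nonzero primes
  are maximal, so invertibility of nonzero ideals has to be derived. One construction serves twice:
  a proper nonzero ideal \<open>I\<close> is enlarged to \<open>J\<close> with
  \<open>P J \<subseteq> I\<close> for a maximal ideal \<open>P\<close>, and Noetherian induction
  passes from \<open>J\<close> to \<open>I\<close>, both for invertibility and for the
  approximation. The obstacle in rank at least two is that the image of a functional is an
  invertible ideal that may fail to be principal, so splitting along it need not yield a free
  summand. A second dimension removes it: functionals that agree with \<open>\<chi>\<close> on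
  \<open>ker \<phi>\<close> all have the nonzero ideal \<open>I = \<chi> (ker \<phi>)\<close> in
  their image, so the value 1 has to be reached only modulo \<open>I\<close>, using the freedom off
  \<open>ker \<phi>\<close>. Rank enters through one alternative: whether or not there are two
  independent elements.\<close>

lemma (in module) subspace_sum_sets:
  "subspace A \<Longrightarrow> subspace B \<Longrightarrow> subspace (sum_sets A B)"
proof -
  assume A: "subspace A" and B: "subspace B"
  show ?thesis
    unfolding sum_sets_def
  proof (rule subspaceI)
    show "0 \<in> {a + b |a b. a \<in> A \<and> b \<in> B}"
      using subspace_0[OF A] subspace_0[OF B] by force
  next
    fix x y assume "x \<in> {a + b |a b. a \<in> A \<and> b \<in> B}" "y \<in> {a + b |a b. a \<in> A \<and> b \<in> B}"
    then obtain a b a' b' where "x = a + b" "y = a' + b'" "a \<in> A" "b \<in> B" "a' \<in> A" "b' \<in> B" by blast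
    then have "x + y = (a + a') + (b + b')" "a + a' \<in> A" "b + b' \<in> B"
      using subspace_add[OF A] subspace_add[OF B] by (auto simp: ac_simps)
    then show "x + y \<in> {a + b |a b. a \<in> A \<and> b \<in> B}" by blast
  next
    fix c x assume "x \<in> {a + b |a b. a \<in> A \<and> b \<in> B}"
    then obtain a b where "x = a + b" "a \<in> A" "b \<in> B" by blast
    then have "c *s x = c *s a + c *s b" "c *s a \<in> A" "c *s b \<in> B"
      using subspace_scale[OF A] subspace_scale[OF B] by (auto simp: scale_right_distrib)
    then show "c *s x \<in> {a + b |a b. a \<in> A \<and> b \<in> B}" by blast
  qed
qed

global_interpretation ideal: module "(*) :: 'a::idom \<Rightarrow> 'a \<Rightarrow> 'a"
  by unfold_locales (simp_all only: distrib_left distrib_right mult.assoc mult_1_left to_fract_add to_fract_mult to_fract_1)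

global_interpretation fract: module "\<lambda>(d::'a::idom) y. to_fract d * y"
  by unfold_locales (simp_all only: distrib_left distrib_right mult.assoc mult_1_left to_fract_add to_fract_mult to_fract_1)

text \<open>These would rewrite against \<open>mult.assoc\<close>.\<close>

declare ideal.scale_scale [simp del] fract.scale_scale [simp del]

section \<open>Noetherian induction and maximal ideals\<close>

text \<open>Zorn's lemma applies because the union of a chain is a finitely generated ideal: its
  generators lie in one member, which is then the whole union and belongs to
  \<open>F\<close>.\<close>

lemma noetherian_maximal:
  fixes F :: "'a::idom set set"
  assumes noeth: "noetherian_domain TYPE('a)" and ideals: "\<And>I. I \<in> F \<Longrightarrow> is_ideal I" and "F \<noteq> {}"
  shows "\<exists>I\<in>F. \<forall>J\<in>F. I \<subseteq> J \<longrightarrow> J = I"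
proof (rule subset_Zorn_nonempty)
  fix C assume C: "C \<noteq> {}" "subset.chain F C"
  have CF: "C \<subseteq> F" using C(2) by (simp add: subset.chain_def)
  have "is_ideal (\<Union>C)"
  proof (rule ideal.subspaceI)
    show "0 \<in> \<Union>C" using C(1) CF ideals ideal.subspace_0 by blast
  next
    fix x y assume "x \<in> \<Union>C" "y \<in> \<Union>C"
    then have "finite {x, y}" "{x, y} \<subseteq> \<Union>C" by auto
    then obtain B where "B \<in> C" "{x, y} \<subseteq> B"
      using finite_subset_Union_chain C by metis
    moreover from this have "is_ideal B" using CF ideals by blast
    ultimately have "x + y \<in> B" using ideal.subspace_add[of B x y] by simp
    then show "x + y \<in> \<Union>C" using \<open>B \<in> C\<close> by blast
  next
    fix c x assume "x \<in> \<Union>C"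
    then obtain B where B: "B \<in> C" "x \<in> B" by blast
    then have "is_ideal B" using CF ideals by blast
    then have "c * x \<in> B" using ideal.subspace_scale[of B x c] B(2) by simp
    then show "c * x \<in> \<Union>C" using B(1) by blast
  qed
  then obtain S where S: "finite S" "\<Union>C = ideal.span S"
    using noeth unfolding noetherian_domain_def by blast
  then have "S \<subseteq> \<Union>C" using ideal.span_superset by blast
  then obtain B where B: "B \<in> C" "S \<subseteq> B"
    using finite_subset_Union_chain[OF S(1)] C by metis
  then have "\<Union>C \<subseteq> B" unfolding S(2) using CF ideals by (intro ideal.span_minimal) auto
  then have "\<Union>C = B" using B by blast
  then show "\<Union>C \<in> F" using B CF by blast
qed fact

lemma noetherian_induct [consumes 2]:
  fixes I :: "'a::idom set"
  assumes noeth: "noetherian_domain TYPE('a)" and "is_ideal I"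
    and step: "\<And>I. is_ideal I \<Longrightarrow> (\<And>J. is_ideal J \<Longrightarrow> I \<subset> J \<Longrightarrow> Q J) \<Longrightarrow> Q I"
  shows "Q I"
proof (rule ccontr)
  assume "\<not> Q I"
  then have "{J. is_ideal J \<and> \<not> Q J} \<noteq> {}" using assms(2) by blast
  then obtain J where "J \<in> {J. is_ideal J \<and> \<not> Q J}"
    "\<forall>K\<in>{J. is_ideal J \<and> \<not> Q J}. J \<subseteq> K \<longrightarrow> K = J"
    using noetherian_maximal[OF noeth] by (metis (no_types, lifting) mem_Collect_eq)
  then show False using step[of J] by blast
qed

lemma ideal_eq_UNIV_iff: "is_ideal (I :: 'a::idom set) \<Longrightarrow> I = UNIV \<longleftrightarrow> 1 \<in> I"
  by (metis UNIV_I UNIV_eq_I ideal.subspace_scale mult.right_neutral)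

lemma ideal_eq_0_iff: "is_ideal (I :: 'a::idom set) \<Longrightarrow> I = {0} \<longleftrightarrow> (\<forall>a\<in>I. a = 0)"
  using ideal.subspace_0 by fastforce

lemma maximal_ideal_comaximal:
  assumes "maximal_ideal P" "is_ideal I" "\<not> I \<subseteq> P"
  shows "\<exists>p\<in>P. \<exists>c\<in>I. p + c = 1"
proof -
  have P: "is_ideal P" using assms by (simp add: maximal_ideal_def)
  have "is_ideal (sum_sets P I)" by (rule ideal.subspace_sum_sets[OF P assms(2)])
  moreover have "P \<subseteq> sum_sets P I" "I \<subseteq> sum_sets P I"
    unfolding sum_sets_def using ideal.subspace_0[OF P] ideal.subspace_0[OF assms(2)] by force+
  ultimately have "sum_sets P I = UNIV"
    using assms unfolding maximal_ideal_def by blast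
  then have "1 \<in> sum_sets P I" by simp
  then show ?thesis unfolding sum_sets_def by force
qed

lemma ideal_le_maximal:
  fixes I :: "'a::idom set"
  assumes noeth: "noetherian_domain TYPE('a)" and "is_ideal I" "I \<noteq> UNIV"
  shows "\<exists>P. maximal_ideal P \<and> I \<subseteq> P"
proof -
  let ?F = "{J. is_ideal J \<and> J \<noteq> UNIV \<and> I \<subseteq> J}"
  have "?F \<noteq> {}" using assms by blast
  then have "\<exists>P\<in>?F. \<forall>J\<in>?F. P \<subseteq> J \<longrightarrow> J = P"
    by (intro noetherian_maximal[OF noeth]) simp_all
  then obtain P where P: "P \<in> ?F" "\<forall>J\<in>?F. P \<subseteq> J \<longrightarrow> J = P" ..
  have "maximal_ideal P"
    unfolding maximal_ideal_def
  proof (intro conjI allI impI)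
    fix J assume J: "is_ideal J \<and> P \<subseteq> J"
    show "J = P \<or> J = UNIV"
    proof (cases "J = UNIV")
      case False
      then have "J \<in> ?F" using J P(1) by auto
      then show ?thesis using P(2) J by simp
    qed simp
  qed (use P(1) in simp_all)
  then show ?thesis using P(1) by blast
qed

text \<open>The ideals generated by \<open>a, a y, \<dots>, a y\<^sup>n\<^sup>-\<^sup>1\<close> stabilise, which yields a monic equation for \<open>y\<close>.\<close>

lemma ideal_stabilizer_integral:
  fixes I :: "'a::idom set"
  assumes noeth: "noetherian_domain TYPE('a)" and ic: "integrally_closed TYPE('a)"
    and "is_ideal I" "I \<noteq> {0}"
    and y: "\<And>a. a \<in> I \<Longrightarrow> \<exists>b\<in>I. to_fract a * y = to_fract b"
  shows "y \<in> range to_fract"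
proof -
  obtain a where a: "a \<in> I" "a \<noteq> 0"
    using assms(3,4) by (auto simp: ideal_eq_0_iff)
  \<comment> \<open>\<open>g\<close> is multiplication by \<open>y\<close> carried out inside
    \<open>I\<close>, so its iterates stay in \<open>D\<close>.\<close>
  obtain g where g: "\<And>a. a \<in> I \<Longrightarrow> g a \<in> I" "\<And>a. a \<in> I \<Longrightarrow> to_fract a * y = to_fract (g a)"
    using y by metis
  define h where "h n = (g ^^ n) a" for n
  have hI: "h n \<in> I" for n by (induction n) (auto simp: h_def a g(1))
  have h: "to_fract (h n) = to_fract a * y ^ n" for n
  proof (induction n)
    case (Suc n)
    have "to_fract (h (Suc n)) = to_fract (h n) * y"
      using g(2)[OF hI[of n]] by (simp add: h_def)
    then show ?case by (simp add: Suc)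
  qed (simp add: h_def)
  \<comment> \<open>With explicit sums in place of a span, membership of \<open>h n\<close> in
    \<open>E n\<close> directly yields the coefficients of the monic polynomial.\<close>
  define E where "E n = {\<Sum>i<n. c i * h i |c. True}" for n :: nat
  have E_ideal: "is_ideal (E n)" for n
  proof (rule ideal.subspaceI)
    show "0 \<in> E n" by (auto simp: E_def intro!: exI[of _ "\<lambda>_. 0"])
  next
    fix u v assume "u \<in> E n" "v \<in> E n"
    then obtain c d where "u = (\<Sum>i<n. c i * h i)" "v = (\<Sum>i<n. d i * h i)" by (auto simp: E_def)
    then have "u + v = (\<Sum>i<n. (c i + d i) * h i)" by (simp add: sum.distrib distrib_right)
    then show "u + v \<in> E n" unfolding E_def by (intro CollectI exI[of _ "\<lambda>i. c i + d i"]) simp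
  next
    fix d u assume "u \<in> E n"
    then obtain c where "u = (\<Sum>i<n. c i * h i)" by (auto simp: E_def)
    then have "d * u = (\<Sum>i<n. (d * c i) * h i)" by (simp only: sum_distrib_left mult.assoc)
    then show "d * u \<in> E n" unfolding E_def by (intro CollectI exI[of _ "\<lambda>i. d * c i"]) simp
  qed
  have E_mono: "E n \<subseteq> E (Suc n)" for n
  proof
    fix u assume "u \<in> E n"
    then obtain c where "u = (\<Sum>i<n. c i * h i)" by (auto simp: E_def)
    then have "u = (\<Sum>i<Suc n. (if i = n then 0 else c i) * h i)" by simp
    then show "u \<in> E (Suc n)" unfolding E_def
      by (intro CollectI exI[of _ "\<lambda>i. if i = n then 0 else c i"]) simp
  qed
  have h_mem: "h n \<in> E (Suc n)" for n
    unfolding E_def by (intro CollectI exI[of _ "\<lambda>i. if i = n then 1 else 0"]) simp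
  obtain n where "\<forall>J\<in>range E. E n \<subseteq> J \<longrightarrow> J = E n"
    using noetherian_maximal[OF noeth, of "range E"] E_ideal by (metis (no_types, lifting) imageE empty_not_UNIV image_is_empty)
  then have "E (Suc n) = E n" using E_mono by blast
  with h_mem[of n] have "h n \<in> E n" by simp
  then obtain c where c: "h n = (\<Sum>i<n. c i * h i)" by (auto simp: E_def)
  \<comment> \<open>As \<open>h i\<close> represents \<open>a * y ^ i\<close>, dividing the relation
    for \<open>h n\<close> by \<open>a\<close> expresses \<open>y ^ n\<close> through lower powers
    of \<open>y\<close>.\<close>
  define p where "p = monom 1 n - (\<Sum>i<n. monom (c i) i)"
  have coeff_p: "coeff p k = (if k = n then 1 else if k < n then - c k else 0)" for k
    by (auto simp: p_def coeff_sum)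
  have deg: "degree p = n"
  proof (rule antisym)
    show "degree p \<le> n" by (rule degree_le) (auto simp: coeff_p)
    show "n \<le> degree p" by (rule le_degree) (auto simp: coeff_p)
  qed
  have "poly (fract_poly p) y = (\<Sum>i\<le>n. to_fract (coeff p i) * y ^ i)"
    by (simp add: poly_altdef deg coeff_map_poly degree_map_poly)
  also have "\<dots> = (\<Sum>i<n. to_fract (coeff p i) * y ^ i) + to_fract (coeff p n) * y ^ n"
    by (simp flip: lessThan_Suc_atMost)
  also have "\<dots> = y ^ n - (\<Sum>i<n. to_fract (c i) * y ^ i)"
    by (simp add: coeff_p sum_negf)
  finally have eval: "poly (fract_poly p) y = y ^ n - (\<Sum>i<n. to_fract (c i) * y ^ i)" .
  have "to_fract a * y ^ n = to_fract (\<Sum>i<n. c i * h i)"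
    by (simp add: h[symmetric] c[symmetric])
  also have "\<dots> = to_fract a * (\<Sum>i<n. to_fract (c i) * y ^ i)"
    by (simp only: to_fract_sum to_fract_mult h sum_distrib_left mult.left_commute)
  finally have "poly (fract_poly p) y = 0" using a eval by simp
  moreover have "lead_coeff p = 1" by (simp add: deg coeff_p)
  ultimately show ?thesis using ic unfolding integrally_closed_def by blast
qed

text \<open>For \<open>0 \<noteq> a \<in> P\<close>, a colon ideal \<open>(a) : b\<close> that is maximal among those contained in \<open>P\<close>
  is prime, hence equal to \<open>P\<close>; the fraction is \<open>b / a\<close>.\<close>

lemma maximal_ideal_fraction:
  fixes P :: "'a::idom set"
  assumes ded: "dedekind_domain TYPE('a)" and max: "maximal_ideal P" and "P \<noteq> {0}"
  shows "\<exists>y. y \<notin> range to_fract \<and> (\<forall>p\<in>P. to_fract p * y \<in> range to_fract)"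
proof -
  have P: "is_ideal P" using max by (simp add: maximal_ideal_def)
  have P1: "1 \<notin> P" using max ideal_eq_UNIV_iff[OF P] by (simp add: maximal_ideal_def)
  obtain a where a: "a \<in> P" "a \<noteq> 0" using assms(3) by (auto simp: ideal_eq_0_iff[OF P])
  \<comment> \<open>Maximal ideals are prime: \<open>p + k * c = 1\<close> with
    \<open>p \<in> P\<close> gives \<open>t = t * p + k * (t * c)\<close>.\<close>
  have P_prime: "t \<in> P \<or> c \<in> P" if "t * c \<in> P" for t c
  proof (rule disjCI)
    assume "c \<notin> P"
    then have "\<not> ideal.span {c} \<subseteq> P" using ideal.span_base by blast
    then obtain p e where "p \<in> P" "p + e = 1" "e \<in> ideal.span {c}"
      using maximal_ideal_comaximal[OF max ideal.subspace_span] by blast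
    moreover obtain k where "e = k * c" using \<open>e \<in> ideal.span {c}\<close> by (auto simp: ideal.span_singleton)
    ultimately have pe: "p \<in> P" "p + k * c = 1" by auto
    have "t = t * (p + k * c)" using pe by simp
    also have "\<dots> = t * p + k * (t * c)" by (simp only: distrib_left mult.left_commute)
    finally have "t = t * p + k * (t * c)" .
    then show "t \<in> P" using that pe(1) P
      by (metis ideal.subspace_add ideal.subspace_scale)
  qed
  define Col where "Col b = {c. a dvd c * b}" for b
  have Col_ideal: "is_ideal (Col b)" for b
    by (rule ideal.subspaceI) (auto simp: Col_def algebra_simps)
  have Col_mono: "Col b \<subseteq> Col (t * b)" for b t
  proof
    fix c assume "c \<in> Col b"
    then have "a dvd t * (c * b)" by (simp add: Col_def)
    then show "c \<in> Col (t * b)" by (simp only: Col_def mem_Collect_eq mult.left_commute)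
  qed
  let ?F = "{Col b |b. Col b \<subseteq> P}"
  have "Col 1 \<subseteq> P"
  proof
    fix c assume "c \<in> Col 1"
    then obtain k where "c = k * a" by (auto simp: Col_def dvd_def mult.commute)
    then show "c \<in> P" using P a ideal.subspace_scale by blast
  qed
  then have "Col 1 \<in> ?F" by blast
  then have "?F \<noteq> {}" by (metis empty_iff)
  have "\<exists>Q\<in>?F. \<forall>J\<in>?F. Q \<subseteq> J \<longrightarrow> J = Q"
  proof (rule noetherian_maximal)
    show "noetherian_domain TYPE('a)" using ded by (simp add: dedekind_domain_def)
    show "is_ideal I" if "I \<in> ?F" for I using that Col_ideal by blast
    show "?F \<noteq> {}" by fact
  qed
  then obtain Q where Q: "Q \<in> ?F" "\<forall>J\<in>?F. Q \<subseteq> J \<longrightarrow> J = Q" ..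
  then obtain b where b: "Col b \<subseteq> P" "Q = Col b" by blast
  have bmax: "Col b' = Col b" if "Col b' \<subseteq> P" "Col b \<subseteq> Col b'" for b'
  proof -
    have "Col b' \<in> ?F" using that(1) by blast
    then show ?thesis using Q(2) that(2) b(2) by simp
  qed
  \<comment> \<open>For \<open>t \<notin> P\<close>, primality of \<open>P\<close> keeps the colon
    ideal of \<open>t * b\<close> inside \<open>P\<close>, so maximality leaves it
    unchanged.\<close>
  have Col_t: "Col (t * b) = Col b" if "t \<notin> P" for t
  proof (rule bmax[OF _ Col_mono])
    show "Col (t * b) \<subseteq> P"
    proof
      fix c assume "c \<in> Col (t * b)"
      then have "c * t \<in> Col b" by (simp add: Col_def mult.assoc)
      then show "c \<in> P" using b(1) P_prime that by blast
    qed
  qed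
  have "prime_ideal (Col b)"
    unfolding prime_ideal_def
  proof (intro conjI allI impI)
    show "Col b \<noteq> UNIV" using b(1) P1 by blast
    fix u v assume uv: "u * v \<in> Col b"
    \<comment> \<open>If \<open>Col (u * b)\<close> stays inside \<open>P\<close>, it equals
      \<open>Col b\<close> and contains \<open>v\<close>; otherwise some \<open>t \<notin> P\<close>
      in it has \<open>u \<in> Col (t * b) = Col b\<close>.\<close>
    show "u \<in> Col b \<or> v \<in> Col b"
    proof (cases "Col (u * b) \<subseteq> P")
      case True
      then have "Col (u * b) = Col b" by (rule bmax[OF _ Col_mono])
      moreover have "v \<in> Col (u * b)" using uv by (simp add: Col_def ac_simps)
      ultimately show ?thesis by simp
    next
      case False
      then obtain t where t: "t \<notin> P" "t \<in> Col (u * b)" by blast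
      then have "u \<in> Col (t * b)" by (simp add: Col_def ac_simps)
      then show ?thesis using Col_t t by simp
    qed
  qed (rule Col_ideal)
  moreover have "a \<in> Col b" by (simp add: Col_def)
  then have "Col b \<noteq> {0}" using a by auto
  ultimately have "maximal_ideal (Col b)" using ded unfolding dedekind_domain_def by blast
  then have ColP: "Col b = P" using b(1) P P1 max unfolding maximal_ideal_def by blast
  define y where "y = to_fract b / to_fract a"
  have "to_fract p * y \<in> range to_fract" if "p \<in> P" for p
  proof -
    have "a dvd p * b" using that by (simp add: Col_def flip: ColP)
    then obtain k where "p * b = a * k" by (auto simp: dvd_def)
    then have "to_fract p * to_fract b = to_fract a * to_fract k" by (metis to_fract_mult)
    then have "to_fract p * y = to_fract k" using a by (simp add: y_def field_simps)
    then show ?thesis by simp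
  qed
  moreover have "y \<notin> range to_fract"
  proof
    assume "y \<in> range to_fract"
    then obtain k where "y = to_fract k" by blast
    then have "to_fract b = to_fract (k * a)" using a by (simp add: y_def field_simps)
    then have "b = k * a" by (simp only: to_fract_eq_iff)
    then have "1 \<in> Col b" by (simp add: Col_def)
    then show False using b(1) P1 by blast
  qed
  ultimately show ?thesis by blast
qed

section \<open>Enlarging a proper ideal; invertibility and approximation\<close>

text \<open>With \<open>y\<close> as in \<open>maximal_ideal_fraction\<close>, \<open>J\<close> is
  \<open>I + I y\<close>. This lies in \<open>D\<close> because \<open>I \<subseteq> P\<close> and
  \<open>P y \<subseteq> D\<close>, and the latter inclusion also gives
  \<open>P J \<subseteq> I\<close>. It exceeds \<open>I\<close>, as otherwise \<open>y\<close> would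
  map \<open>I\<close> into itself and belong to \<open>D\<close> by integral closedness.\<close>

lemma proper_ideal_extension:
  fixes I :: "'a::idom set"
  assumes ded: "dedekind_domain TYPE('a)" and I: "is_ideal I" "I \<noteq> {0}" "I \<noteq> UNIV"
  obtains P y J where "maximal_ideal P" "I \<subseteq> P" "is_ideal J" "I \<subset> J"
    "J = {c. \<exists>a\<in>I. \<exists>b\<in>I. to_fract c = to_fract a + to_fract b * y}"
    "\<And>b. b \<in> I \<Longrightarrow> to_fract b * y \<in> to_fract ` J"
    "\<And>p c. p \<in> P \<Longrightarrow> c \<in> J \<Longrightarrow> p * c \<in> I"
proof -
  have noeth: "noetherian_domain TYPE('a)" and ic: "integrally_closed TYPE('a)"
    using ded by (auto simp: dedekind_domain_def)
  obtain P where P: "maximal_ideal P" "I \<subseteq> P" using ideal_le_maximal[OF noeth I(1,3)] by blast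
  then have "P \<noteq> {0}" using I(1,2) ideal.subspace_0 by blast
  then obtain y where y: "y \<notin> range to_fract" "\<And>p. p \<in> P \<Longrightarrow> to_fract p * y \<in> range to_fract"
    using maximal_ideal_fraction[OF ded P(1)] by blast
  define J where "J = {c. \<exists>a\<in>I. \<exists>b\<in>I. to_fract c = to_fract a + to_fract b * y}"
  note I0 = ideal.subspace_0[OF I(1)]
  have yJ: "to_fract b * y \<in> to_fract ` J" if "b \<in> I" for b
  proof -
    have "b \<in> P" using that P(2) by blast
    then obtain c where c: "to_fract b * y = to_fract c" using y(2)[of b] by auto
    then have "c \<in> J" using that I0 unfolding J_def by force
    then show ?thesis using c by simp
  qed
  have J: "is_ideal J"
  proof (rule ideal.subspaceI)
    show "0 \<in> J" using I0 unfolding J_def by force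
  next
    fix u v assume "u \<in> J" "v \<in> J"
    then obtain a b a' b' where "a \<in> I" "b \<in> I" "a' \<in> I" "b' \<in> I"
      "to_fract u = to_fract a + to_fract b * y" "to_fract v = to_fract a' + to_fract b' * y"
      unfolding J_def by blast
    then have "a + a' \<in> I" "b + b' \<in> I" "to_fract (u + v) = to_fract (a + a') + to_fract (b + b') * y"
      using ideal.subspace_add[OF I(1)] by (auto simp: algebra_simps)
    then show "u + v \<in> J" unfolding J_def by blast
  next
    fix d u assume "u \<in> J"
    then obtain a b where "a \<in> I" "b \<in> I" "to_fract u = to_fract a + to_fract b * y"
      unfolding J_def by blast
    then have "d * a \<in> I" "d * b \<in> I" "to_fract (d * u) = to_fract (d * a) + to_fract (d * b) * y"
      using ideal.subspace_scale[OF I(1)] by (auto simp: algebra_simps)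
    then show "d * u \<in> J" unfolding J_def by blast
  qed
  have "I \<subseteq> J" using I0 unfolding J_def by force
  moreover have "J \<noteq> I"
  proof
    assume "J = I"
    then have "y \<in> range to_fract"
      using yJ by (intro ideal_stabilizer_integral[OF noeth ic I(1,2)]) auto
    then show False using y by simp
  qed
  ultimately have IJ: "I \<subset> J" by blast
  have "p * c \<in> I" if p: "p \<in> P" and c: "c \<in> J" for p c
  proof -
    obtain a b where ab: "a \<in> I" "b \<in> I" "to_fract c = to_fract a + to_fract b * y"
      using c unfolding J_def by blast
    obtain k where k: "to_fract p * y = to_fract k" using y(2)[OF p] by blast
    have "to_fract (p * c) = to_fract p * to_fract a + to_fract b * (to_fract p * y)"
      using ab by (simp add: algebra_simps)
    also have "\<dots> = to_fract (p * a + k * b)" by (simp add: k)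
    finally have "p * c = p * a + k * b" by (simp only: to_fract_eq_iff)
    then show ?thesis using ab I(1) by (simp add: ideal.subspace_add ideal.subspace_scale)
  qed
  then show ?thesis using that[OF P J IJ J_def yJ] by blast
qed

text \<open>By the choice of the inverse the products generate a submodule of \<open>D\<close>; it
  is all of \<open>D\<close> as soon as it contains 1.\<close>

lemma invertible_idealI:
  assumes "is_ideal I" "1 \<in> fract.span {to_fract a * y |a y. a \<in> I \<and> y \<in> inverse_ideal I}"
  shows "invertible_ideal I"
  unfolding invertible_ideal_def
proof (intro conjI equalityI)
  have "fract.subspace (range (to_fract :: 'a \<Rightarrow> _))"
    by (rule fract.subspaceI) (auto simp flip: to_fract_add to_fract_mult to_fract_0)
  then show "fract.span {to_fract a * y |a y. a \<in> I \<and> y \<in> inverse_ideal I} \<subseteq> range to_fract"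
    by (rule fract.span_minimal[rotated]) (auto simp: inverse_ideal_def)
  show "range to_fract \<subseteq> fract.span {to_fract a * y |a y. a \<in> I \<and> y \<in> inverse_ideal I}"
  proof
    fix x :: "'a fract" assume "x \<in> range to_fract"
    then obtain d where "x = to_fract d" by blast
    then show "x \<in> fract.span {to_fract a * y |a y. a \<in> I \<and> y \<in> inverse_ideal I}"
      using fract.span_scale[OF assms(2), of d] by simp
  qed
qed fact

text \<open>Invertibility descends from \<open>J = I + I y\<close> to \<open>I\<close>: for
  \<open>z\<close> in the inverse of \<open>J\<close>, both \<open>z\<close> and
  \<open>y * z\<close> lie in the inverse of \<open>I\<close>, and
  \<open>(a + b * y) * z = a * z + b * (y * z)\<close>.\<close>

lemma dedekind_invertible:
  fixes I :: "'a::idom set"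
  assumes ded: "dedekind_domain TYPE('a)" and "is_ideal I" "I \<noteq> {0}"
  shows "invertible_ideal I"
proof -
  let ?G = "\<lambda>I::'a set. {to_fract a * y |a y. a \<in> I \<and> y \<in> inverse_ideal I}"
  have noeth: "noetherian_domain TYPE('a)" using ded by (auto simp: dedekind_domain_def)
  from noeth assms(2) have "I \<noteq> {0} \<longrightarrow> 1 \<in> fract.span (?G I)"
  proof (induction rule: noetherian_induct)
    case (1 I)
    show ?case
    proof
      assume "I \<noteq> {0}"
      show "1 \<in> fract.span (?G I)"
      proof (cases "I = UNIV")
        case True
        then have "to_fract 1 * 1 \<in> ?G I" unfolding inverse_ideal_def
          by (intro CollectI exI[of _ 1]) simp
        then show ?thesis using fract.span_base[of 1 "?G I"] by simp
      next
        case False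
        from ded 1(1) \<open>I \<noteq> {0}\<close> False obtain P y J where "is_ideal J" "I \<subset> J" and
          J: "J = {c. \<exists>a\<in>I. \<exists>b\<in>I. to_fract c = to_fract a + to_fract b * y}"
          and yJ: "\<And>b. b \<in> I \<Longrightarrow> to_fract b * y \<in> to_fract ` J"
          by (rule proper_ideal_extension) (rule that)
        moreover have "J \<noteq> {0}" using \<open>I \<subset> J\<close> ideal.subspace_0[OF 1(1)] by blast
        ultimately have "1 \<in> fract.span (?G J)" using 1(2) by blast
        moreover have "?G J \<subseteq> fract.span (?G I)"
        proof
          fix u assume "u \<in> ?G J"
          then obtain c z where u: "u = to_fract c * z" "c \<in> J" and z: "z \<in> inverse_ideal J" by blast
          obtain a b where ab: "a \<in> I" "b \<in> I" "to_fract c = to_fract a + to_fract b * y"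
            using u(2) unfolding J by blast
          have "z \<in> inverse_ideal I" using z \<open>I \<subset> J\<close> by (auto simp: inverse_ideal_def)
          moreover have "y * z \<in> inverse_ideal I"
            unfolding inverse_ideal_def
          proof (intro CollectI ballI)
            fix b assume "b \<in> I"
            then obtain c where "c \<in> J" "to_fract b * y = to_fract c" using yJ by blast
            then show "to_fract b * (y * z) \<in> range to_fract"
              using z by (simp add: inverse_ideal_def flip: mult.assoc)
          qed
          ultimately have "to_fract a * z \<in> ?G I" "to_fract b * (y * z) \<in> ?G I" using ab by blast+
          then have "to_fract a * z + to_fract b * (y * z) \<in> fract.span (?G I)"
            by (intro fract.span_add fract.span_base)
          then show "u \<in> fract.span (?G I)" using ab u by (simp add: algebra_simps)
        qed
        ultimately show ?thesis using fract.span_mono fract.span_span by blast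
      qed
    qed
  qed
  then show ?thesis using assms by (intro invertible_idealI) auto
qed

text \<open>Noetherian induction on \<open>I\<close>: let \<open>I \<subset> J\<close> and \<open>P J \<subseteq> I\<close> as in \<open>proper_ideal_extension\<close>. If \<open>J \<subseteq> P\<close>, the
  functional found for \<open>J\<close> also serves for \<open>I\<close>; otherwise it is combined, by the Chinese remainder
  theorem, with one that does not map into \<open>P\<close>.\<close>

lemma comaximal_functional:
  fixes I :: "'a::idom set" and \<Psi> :: "('b::ab_group_add \<Rightarrow> 'a) set" and s :: "'a \<Rightarrow> 'b \<Rightarrow> 'b"
  assumes ded: "dedekind_domain TYPE('a)" and "is_ideal I" "I \<noteq> {0}"
    and nonempty: "\<Psi> \<noteq> {}"
    and add: "\<And>\<psi> x y. \<psi> \<in> \<Psi> \<Longrightarrow> \<psi> (x + y) = \<psi> x + \<psi> y"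
    and scale: "\<And>\<psi> d x. \<psi> \<in> \<Psi> \<Longrightarrow> \<psi> (s d x) = d * \<psi> x"
    and affine: "\<And>\<psi> \<upsilon> p. \<psi> \<in> \<Psi> \<Longrightarrow> \<upsilon> \<in> \<Psi> \<Longrightarrow> (\<lambda>x. p * \<psi> x + (1 - p) * \<upsilon> x) \<in> \<Psi>"
    and locally: "\<And>P. maximal_ideal P \<Longrightarrow> \<exists>\<psi>\<in>\<Psi>. \<exists>x. \<psi> x \<notin> P"
  shows "\<exists>\<psi>\<in>\<Psi>. \<exists>x. 1 - \<psi> x \<in> I"
proof -
  have noeth: "noetherian_domain TYPE('a)" using ded by (auto simp: dedekind_domain_def)
  from noeth assms(2) have "I \<noteq> {0} \<longrightarrow> (\<exists>\<psi>\<in>\<Psi>. \<exists>x. 1 - \<psi> x \<in> I)"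
  proof (induction rule: noetherian_induct)
    case (1 I)
    show ?case
    proof
      assume "I \<noteq> {0}"
      show "\<exists>\<psi>\<in>\<Psi>. \<exists>x. 1 - \<psi> x \<in> I"
      proof (cases "I = UNIV")
        case True
        then show ?thesis using nonempty by auto
      next
        case False
        from ded 1(1) \<open>I \<noteq> {0}\<close> False obtain P J where max: "maximal_ideal P"
          and J: "is_ideal J" "I \<subset> J" and PJ: "\<And>p c. p \<in> P \<Longrightarrow> c \<in> J \<Longrightarrow> p * c \<in> I"
          by (rule proper_ideal_extension) (rule that)
        have P: "is_ideal P" using max by (simp add: maximal_ideal_def)
        have "J \<noteq> {0}" using \<open>I \<subset> J\<close> ideal.subspace_0[OF 1(1)] by blast
        then obtain \<psi> x where \<psi>: "\<psi> \<in> \<Psi>" "1 - \<psi> x \<in> J" using 1(2) J by blast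
        show ?thesis
        proof (cases "J \<subseteq> P")
          case True
          \<comment> \<open>\<open>b\<close> lies in \<open>J \<subseteq> P\<close>, so
            \<open>b * b\<close> lies in \<open>P J \<subseteq> I\<close>. Scaling \<open>x\<close>
            by \<open>1 + b\<close> replaces the error \<open>b\<close> by \<open>b * b\<close>, as
            in a Newton step.\<close>
          define b where "b = 1 - \<psi> x"
          have "\<psi> (s (1 + b) x) = (1 + b) * (1 - b)" by (simp add: scale \<psi>(1) b_def)
          then have "1 - \<psi> (s (1 + b) x) = b * b" by (simp add: algebra_simps)
          also have "\<dots> \<in> I" using PJ[of b b] True \<psi>(2) b_def by blast
          finally show ?thesis using \<psi>(1) by blast
        next
          case False
          then obtain p c where pc: "p \<in> P" "c \<in> J" "p + c = 1"
            using maximal_ideal_comaximal[OF max J(1)] by blast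
          obtain \<upsilon> v where \<upsilon>: "\<upsilon> \<in> \<Psi>" "\<upsilon> v \<notin> P" using locally[OF max] by blast
          then have "\<not> ideal.span {\<upsilon> v} \<subseteq> P" using ideal.span_base by blast
          then obtain q e where "q \<in> P" "q + e = 1" "e \<in> ideal.span {\<upsilon> v}"
            using maximal_ideal_comaximal[OF max ideal.subspace_span] by blast
          moreover obtain k where "e = k * \<upsilon> v" using \<open>e \<in> ideal.span {\<upsilon> v}\<close>
            by (auto simp: ideal.span_singleton)
          ultimately have q: "1 - \<upsilon> (s k v) \<in> P" using scale[OF \<upsilon>(1)]
            by (metis add_diff_cancel_right')
          define w where "w = s k v"
          \<comment> \<open>\<open>\<rho>\<close> agrees with \<open>\<psi>\<close> modulo
            \<open>J\<close>, since \<open>1 - p = c \<in> J\<close>, and with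
            \<open>\<upsilon>\<close> modulo \<open>P\<close>, since
            \<open>p \<in> P\<close>.\<close>
          define \<rho> where "\<rho> x = p * \<psi> x + (1 - p) * \<upsilon> x" for x
          have \<rho>: "\<rho> \<in> \<Psi>" unfolding \<rho>_def[abs_def] using affine \<psi>(1) \<upsilon>(1) by blast
          have c: "c = 1 - p" using pc(3) by (simp add: algebra_simps)
          have "1 - \<rho> x = (1 - \<psi> x) + (\<psi> x - \<upsilon> x) * c" by (simp add: \<rho>_def c algebra_simps)
          also have "\<dots> \<in> J" using J(1) \<psi>(2) pc(2) by (intro ideal.subspace_add ideal.subspace_scale)
          finally have Jx: "1 - \<rho> x \<in> J" .
          have "1 - \<rho> w = (1 - \<upsilon> w) + (\<upsilon> w - \<psi> w) * p" by (simp add: \<rho>_def algebra_simps)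
          also have "\<dots> \<in> P" using P q pc(1) unfolding w_def
            by (intro ideal.subspace_add ideal.subspace_scale)
          finally have Pw: "1 - \<rho> w \<in> P" .
          \<comment> \<open>At the corrected point the error of \<open>x\<close>, in
            \<open>J\<close>, and the error of \<open>w\<close>, in \<open>P\<close>, multiply to
            one in \<open>P J\<close>.\<close>
          have "1 - \<rho> (x + s (1 - \<rho> x) w) = (1 - \<rho> w) * (1 - \<rho> x)"
            by (simp add: add[OF \<rho>] scale[OF \<rho>] algebra_simps)
          also have "\<dots> \<in> I" using PJ Pw Jx by blast
          finally have "\<exists>y. 1 - \<rho> y \<in> I" by blast
          then show ?thesis using \<rho> by blast
        qed
      qed
    qed
  qed
  then show ?thesis using assms by blast
qed

section \<open>Direct sums and functionals\<close>

lemma sum_setsI: "a \<in> A \<Longrightarrow> b \<in> B \<Longrightarrow> a + b \<in> sum_sets A B"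
  unfolding sum_sets_def by blast

lemma sum_setsE: "x \<in> sum_sets A B \<Longrightarrow> (\<And>a b. a \<in> A \<Longrightarrow> b \<in> B \<Longrightarrow> x = a + b \<Longrightarrow> thesis) \<Longrightarrow> thesis"
  unfolding sum_sets_def by blast

lemma sum_sets_commute: "sum_sets A B = sum_sets B A"
proof -
  have "sum_sets A B \<subseteq> sum_sets B A" for A B :: "'a set"
  proof
    fix x assume "x \<in> sum_sets A B"
    then obtain a b where "a \<in> A" "b \<in> B" "x = a + b" by (rule sum_setsE)
    then show "x \<in> sum_sets B A" using sum_setsI[of b B a A] by (simp add: add.commute)
  qed
  then show ?thesis by blast
qed

locale idom_module = module scale
  for scale :: "'a::idom \<Rightarrow> 'b::ab_group_add \<Rightarrow> 'b" (infixr \<open>*s\<close> 75)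
begin

lemma direct_sumD:
  assumes "direct_sum scale X A B"
  shows "subspace A" "subspace B" "subspace X" "A \<subseteq> X" "B \<subseteq> X" "X = sum_sets A B" "A \<inter> B = {0}"
proof -
  show *: "subspace A" "subspace B" "X = sum_sets A B" "A \<inter> B = {0}"
    using assms by (simp_all add: direct_sum_def)
  show "subspace X" using * by (simp add: subspace_sum_sets)
  show "A \<subseteq> X" using *(3) subspace_0[OF *(2)] by (metis add.right_neutral subsetI sum_setsI)
  show "B \<subseteq> X" using *(3) subspace_0[OF *(1)] by (metis add.left_neutral subsetI sum_setsI)
qed

lemma direct_sumI:
  assumes "subspace A" "subspace B" "subspace X" "A \<subseteq> X" "B \<subseteq> X"
    and "\<And>x. x \<in> X \<Longrightarrow> \<exists>a\<in>A. \<exists>b\<in>B. x = a + b" and "\<And>x. x \<in> A \<Longrightarrow> x \<in> B \<Longrightarrow> x = 0"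
  shows "direct_sum scale X A B"
proof -
  have "sum_sets A B \<subseteq> X" using assms(4,5) subspace_add[OF assms(3)] by (auto elim!: sum_setsE)
  moreover have "X \<subseteq> sum_sets A B"
  proof
    fix x assume "x \<in> X"
    from assms(6)[OF this] show "x \<in> sum_sets A B" by (auto intro: sum_setsI)
  qed
  moreover have "A \<inter> B = {0}" using assms(7) subspace_0[OF assms(1)] subspace_0[OF assms(2)] by auto
  ultimately show ?thesis using assms(1,2) by (auto simp: direct_sum_def)
qed

lemma direct_sum_commute: "direct_sum scale X A B \<Longrightarrow> direct_sum scale X B A"
  by (simp add: direct_sum_def sum_sets_commute[of A] Int_commute[of A])

lemma direct_sum_assoc:
  assumes "direct_sum scale X A B" "direct_sum scale B C E"
  shows "direct_sum scale X (sum_sets A C) E"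
proof -
  note A = direct_sumD[OF assms(1)] and C = direct_sumD[OF assms(2)]
  show ?thesis
  proof (rule direct_sumI)
    show AC: "subspace (sum_sets A C)" "subspace E" "subspace X"
      using A C by (simp_all add: subspace_sum_sets)
    show "sum_sets A C \<subseteq> X" using A(3,4,5) C(4) by (auto elim!: sum_setsE intro: subspace_add)
    show "E \<subseteq> X" using A(5) C(5) by simp
    fix x assume "x \<in> X"
    then obtain a b where "a \<in> A" "b \<in> B" "x = a + b" using A(6) by (auto elim: sum_setsE)
    moreover obtain c e where "c \<in> C" "e \<in> E" "b = c + e" using \<open>b \<in> B\<close> C(6) by (auto elim: sum_setsE)
    ultimately have "a + c \<in> sum_sets A C" "e \<in> E" "x = (a + c) + e" by (simp_all add: sum_setsI add.assoc)
    then show "\<exists>a\<in>sum_sets A C. \<exists>b\<in>E. x = a + b" by blast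
  next
    fix x assume x: "x \<in> sum_sets A C" "x \<in> E"
    then obtain a c where ac: "a \<in> A" "c \<in> C" "x = a + c" by (auto elim: sum_setsE)
    then have "a = x - c" by simp
    moreover have "x - c \<in> B" using x(2) ac(2) C(3,4,5) by (auto intro: subspace_diff)
    ultimately have "a = 0" using ac(1) A(7) by blast
    then show "x = 0" using ac x(2) C(7) by auto
  qed
qed

text \<open>The modular law: if \<open>x = a + b\<close> with \<open>x\<close> and \<open>a\<close>
  in \<open>Y\<close>, then \<open>b\<close> is in \<open>Y\<close> too. Thus a summand of a module
  is a summand of every submodule in between.\<close>

lemma direct_sum_modular:
  assumes "direct_sum scale X A B" "subspace Y" "A \<subseteq> Y" "Y \<subseteq> X"
  shows "direct_sum scale Y A (B \<inter> Y)"
proof -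
  note A = direct_sumD[OF assms(1)]
  show ?thesis
  proof (rule direct_sumI)
    fix x assume x: "x \<in> Y"
    then have "x \<in> sum_sets A B" using A(6) assms(4) by blast
    then obtain a b where ab: "a \<in> A" "b \<in> B" "x = a + b" by (rule sum_setsE)
    then have "b = x - a" by simp
    also have "\<dots> \<in> Y" using x ab(1) assms(2,3) by (auto intro: subspace_diff)
    finally show "\<exists>a\<in>A. \<exists>b\<in>B \<inter> Y. x = a + b" using ab by blast
  qed (use assms A in \<open>auto simp: subspace_inter\<close>)
qed

lemma direct_summand_trans:
  assumes "direct_summand scale A B" "direct_summand scale B X"
  shows "direct_summand scale A X"
proof -
  obtain C E where "direct_sum scale B A C" "direct_sum scale X B E"
    using assms unfolding direct_summand_def by blast
  then have "direct_sum scale X (sum_sets E C) A"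
    using direct_sum_assoc[OF direct_sum_commute direct_sum_commute] by blast
  then show ?thesis unfolding direct_summand_def using direct_sum_commute by blast
qed

lemma direct_summand_restrict:
  "direct_summand scale A X \<Longrightarrow> subspace Y \<Longrightarrow> A \<subseteq> Y \<Longrightarrow> Y \<subseteq> X \<Longrightarrow> direct_summand scale A Y"
  unfolding direct_summand_def using direct_sum_modular by blast

section \<open>Linear functionals and their splitting\<close>

abbreviation functional :: "('b \<Rightarrow> 'a) \<Rightarrow> bool"
  where "functional \<phi> \<equiv> module_hom scale (*) \<phi>"

lemma functionalI:
  "(\<And>x y. \<phi> (x + y) = \<phi> x + \<phi> y) \<Longrightarrow> (\<And>d x. \<phi> (d *s x) = d * \<phi> x) \<Longrightarrow> functional \<phi>"
  by (simp add: module_hom_iff module_axioms ideal.module_axioms)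

lemma subspace_kernel:
  assumes "functional \<phi>" "subspace X"
  shows "subspace {x \<in> X. \<phi> x = 0}"
  using subspace_inter[OF assms(2) module_hom.subspace_kernel[OF assms(1)]] by (simp add: Int_def)

text \<open>With \<open>1 = \<Sum> a\<^sub>j y\<^sub>j\<close> for \<open>a\<^sub>j = \<phi> x\<^sub>j\<close> in the image and \<open>y\<^sub>j\<close> in its inverse,
  \<open>a \<mapsto> \<Sum> (a y\<^sub>j) x\<^sub>j\<close> is a section of \<open>\<phi>\<close>.\<close>

lemma functional_splits:
  assumes ded: "dedekind_domain TYPE('a)" and \<phi>: "functional \<phi>" and X: "subspace X"
  obtains J where "direct_sum scale X J {x \<in> X. \<phi> x = 0}" "\<phi> ` J = \<phi> ` X" "inj_on \<phi> J"
proof -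
  interpret \<phi>: module_hom scale "(*)" \<phi> by fact
  define I where "I = \<phi> ` X"
  have I: "is_ideal I" unfolding I_def using \<phi>.subspace_image[OF X] .
  have "\<exists>\<tau>. (\<forall>a\<in>I. \<tau> a \<in> X \<and> \<phi> (\<tau> a) = a) \<and>
      (\<forall>a\<in>I. \<forall>b\<in>I. \<tau> (a + b) = \<tau> a + \<tau> b) \<and> (\<forall>d. \<forall>a\<in>I. \<tau> (d * a) = d *s \<tau> a)"
  \<comment> \<open>The zero ideal is not invertible; for it the zero map is the section.\<close>
  proof (cases "I = {0}")
    case True
    then show ?thesis using subspace_0[OF X] by (intro exI[of _ "\<lambda>_. 0"]) simp
  next
    case False
    let ?G = "{to_fract a * y |a y. a \<in> I \<and> y \<in> inverse_ideal I}"
    \<comment> \<open>A section up to the factor \<open>u\<close>: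
      \<open>\<phi> \<circ> \<tau>\<close> is multiplication by \<open>u\<close>. The condition is
      compatible with \<open>D\<close>-linear combinations in \<open>u\<close>, so span induction
      leads from the products \<open>a y\<close> to \<open>u = 1\<close>.\<close>
    define Sec where "Sec u \<tau> \<longleftrightarrow> (\<forall>a\<in>I. \<tau> a \<in> X \<and> to_fract (\<phi> (\<tau> a)) = to_fract a * u) \<and>
      (\<forall>a\<in>I. \<forall>b\<in>I. \<tau> (a + b) = \<tau> a + \<tau> b) \<and> (\<forall>d. \<forall>a\<in>I. \<tau> (d * a) = d *s \<tau> a)" for u \<tau>
    have gen: "\<exists>\<tau>. Sec u \<tau>" if u: "u \<in> ?G" for u
    proof -
      obtain a y where "a \<in> I" and y: "y \<in> inverse_ideal I" and "u = to_fract a * y"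
        using u by blast
      then obtain x where x: "x \<in> X" and u: "u = to_fract (\<phi> x) * y" unfolding I_def by blast
      have "\<forall>a\<in>I. \<exists>c. to_fract a * y = to_fract c" using y unfolding inverse_ideal_def by blast
      then obtain w where w: "\<And>a. a \<in> I \<Longrightarrow> to_fract a * y = to_fract (w a)" by metis
      have "Sec u (\<lambda>a. w a *s x)"
        unfolding Sec_def
      proof (intro conjI ballI allI)
        fix a assume a: "a \<in> I"
        show "w a *s x \<in> X" using x X by (simp add: subspace_scale)
        show "to_fract (\<phi> (w a *s x)) = to_fract a * u"
          by (simp add: \<phi>.scale u w[OF a, symmetric] mult.commute mult.left_commute)
        fix d
        have "d * a \<in> I" using a I by (simp add: ideal.subspace_scale)
        from w[OF this] have "to_fract (w (d * a)) = to_fract (d * w a)"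
          by (simp add: w[OF a, symmetric] mult.assoc)
        then show "w (d * a) *s x = d *s w a *s x" by (simp only: to_fract_eq_iff scale_scale)
      next
        fix a b assume a: "a \<in> I" "b \<in> I"
        then have "a + b \<in> I" using I by (simp add: ideal.subspace_add)
        from w[OF this] have "to_fract (w (a + b)) = to_fract (w a + w b)"
          by (simp add: a[THEN w, symmetric] distrib_right)
        then show "w (a + b) *s x = w a *s x + w b *s x"
          by (simp only: to_fract_eq_iff scale_left_distrib)
      qed
      then show ?thesis by (intro exI[of "Sec u"])
    qed
    have "1 \<in> fract.span ?G"
      using dedekind_invertible[OF ded I False] unfolding invertible_ideal_def
      by (metis rangeI to_fract_1)
    then have "\<exists>\<tau>. Sec 1 \<tau>"
    proof (induction rule: fract.span_induct_alt)
      case base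
      show ?case using subspace_0[OF X] by (intro exI[of _ "\<lambda>_. 0"]) (simp add: Sec_def \<phi>.zero)
    next
      case (step c u v)
      then obtain \<sigma> \<tau> where "Sec u \<sigma>" "Sec v \<tau>" using gen by blast
      then have "Sec (to_fract c * u + v) (\<lambda>a. c *s \<sigma> a + \<tau> a)"
        unfolding Sec_def using X
        by (simp add: subspace_add subspace_scale \<phi>.add \<phi>.scale scale_right_distrib
            distrib_left mult.left_commute mult.commute add.assoc add.left_commute)
      then show ?case by (intro exI[of "Sec (to_fract c * u + v)"])
    qed
    then show ?thesis by (simp add: Sec_def)
  qed
  then obtain \<tau> where \<tau>: "\<And>a. a \<in> I \<Longrightarrow> \<tau> a \<in> X" "\<And>a. a \<in> I \<Longrightarrow> \<phi> (\<tau> a) = a"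
    "\<And>a b. a \<in> I \<Longrightarrow> b \<in> I \<Longrightarrow> \<tau> (a + b) = \<tau> a + \<tau> b"
    "\<And>d a. a \<in> I \<Longrightarrow> \<tau> (d * a) = d *s \<tau> a" by blast
  define J where "J = \<tau> ` I"
  have \<tau>0: "\<tau> 0 = 0" using \<tau>(4)[of 0 0] ideal.subspace_0[OF I] by simp
  have J: "subspace J"
  proof (rule subspaceI)
    show "0 \<in> J" unfolding J_def using \<tau>0 ideal.subspace_0[OF I] by (metis image_eqI)
  next
    fix x y assume "x \<in> J" "y \<in> J"
    then obtain a b where "a \<in> I" "b \<in> I" "x = \<tau> a" "y = \<tau> b" unfolding J_def by blast
    then have "x + y = \<tau> (a + b)" "a + b \<in> I" using \<tau>(3) I by (simp_all add: ideal.subspace_add)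
    then show "x + y \<in> J" unfolding J_def by blast
  next
    fix c x assume "x \<in> J"
    then obtain a where "a \<in> I" "x = \<tau> a" unfolding J_def by blast
    then have "c *s x = \<tau> (c * a)" "c * a \<in> I" using \<tau>(4) I by (simp_all add: ideal.subspace_scale)
    then show "c *s x \<in> J" unfolding J_def by blast
  qed
  have "direct_sum scale X J {x \<in> X. \<phi> x = 0}"
  proof (rule direct_sumI[OF J subspace_kernel[OF \<phi> X] X])
    show "J \<subseteq> X" using \<tau>(1) by (auto simp: J_def)
    fix x assume x: "x \<in> X"
    then have "\<tau> (\<phi> x) \<in> J" "x - \<tau> (\<phi> x) \<in> X" "\<phi> (x - \<tau> (\<phi> x)) = 0"
      using \<tau>(1,2)[of "\<phi> x"] X by (auto simp: J_def I_def \<phi>.diff subspace_diff)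
    then show "\<exists>a\<in>J. \<exists>b\<in>{x \<in> X. \<phi> x = 0}. x = a + b"
      by (intro bexI[of _ "\<tau> (\<phi> x)"] bexI[of _ "x - \<tau> (\<phi> x)"]) auto
  next
    fix x assume "x \<in> J" "x \<in> {x \<in> X. \<phi> x = 0}"
    then obtain a where "a \<in> I" "x = \<tau> a" "\<phi> x = 0" unfolding J_def by blast
    then show "x = 0" using \<tau>(2) \<tau>0 by simp
  qed auto
  moreover have "\<phi> ` J = \<phi> ` X" unfolding J_def image_image I_def[symmetric] using \<tau>(2) by simp
  moreover have "inj_on \<phi> J" unfolding J_def using \<tau>(2) by (auto simp: inj_on_def)
  ultimately show ?thesis by (rule that)
qed

end

section \<open>Coordinates up to a common denominator, and torsion\<close>

context idom_module
begin

text \<open>A maximal independent set \<open>Z\<close> between \<open>Z0\<close> and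
  \<open>Z0 \<union> S\<close> spans up to torsion: each generator has a nonzero multiple in
  \<open>span Z\<close>, and the product \<open>d\<close> of the multipliers works for the whole
  module. \<open>\<phi> z\<close> is the \<open>z\<close>-coordinate after multiplication by
  \<open>d\<close>. Prescribing \<open>Z0\<close> lets a given independent pair be counted in the
  rank.\<close>

lemma finitely_generated_coordinates:
  assumes fg: "finitely_generated scale" and Z0: "finite Z0" "independent Z0"
  obtains Z d \<phi> where "Z0 \<subseteq> Z" "finite Z" "d \<noteq> 0" "\<And>z. z \<in> Z \<Longrightarrow> functional (\<phi> z)"
    "\<And>z z'. z \<in> Z \<Longrightarrow> z' \<in> Z \<Longrightarrow> \<phi> z z' = (if z = z' then d else 0)"
    "\<And>m. d *s m = (\<Sum>z\<in>Z. \<phi> z m *s z)"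
proof -
  obtain S where S: "finite S" "span S = UNIV"
    using fg unfolding finitely_generated_def by blast
  define F where "F = {Z. Z0 \<subseteq> Z \<and> Z \<subseteq> Z0 \<union> S \<and> independent Z}"
  have "F \<subseteq> Pow (Z0 \<union> S)" by (auto simp: F_def)
  then have "finite F" using S(1) Z0(1) by (meson finite_Pow_iff finite_UnI finite_subset)
  moreover have "Z0 \<in> F" using Z0 by (simp add: F_def)
  ultimately have "\<exists>Z\<in>F. \<forall>Y\<in>F. Z \<le> Y \<longrightarrow> Z = Y"
    by (intro finite_has_maximal) auto
  then obtain Z where Z: "Z \<in> F" "\<And>Y. Y \<in> F \<Longrightarrow> Z \<subseteq> Y \<Longrightarrow> Z = Y" by blast
  have ZF: "Z0 \<subseteq> Z" "Z \<subseteq> Z0 \<union> S" "independent Z" using Z(1) by (simp_all add: F_def)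
  have finZ: "finite Z" using ZF(2) S(1) Z0(1) finite_subset by blast
  have "\<exists>c. c \<noteq> 0 \<and> c *s x \<in> span Z" if x: "x \<in> S" for x
  proof (cases "x \<in> Z")
    case True
    then show ?thesis by (intro exI[of _ 1]) (simp add: span_base)
  next
    case False
    have "insert x Z \<notin> F"
    proof
      assume "insert x Z \<in> F"
      from Z(2)[OF this] show False using False by blast
    qed
    moreover have "Z0 \<subseteq> insert x Z" "insert x Z \<subseteq> Z0 \<union> S" using ZF(1,2) x by auto
    ultimately have "dependent (insert x Z)" unfolding F_def by blast
    then obtain u where u: "\<exists>v\<in>insert x Z. u v \<noteq> 0" "(\<Sum>v\<in>insert x Z. u v *s v) = 0"
      using dependent_finite[of "insert x Z"] finZ by auto
    then have sum0: "u x *s x + (\<Sum>v\<in>Z. u v *s v) = 0" using False finZ by simp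
    have "u x \<noteq> 0"
    proof
      assume "u x = 0"
      then have "\<exists>v\<in>Z. u v \<noteq> 0" "(\<Sum>v\<in>Z. u v *s v) = 0" using u(1) sum0 by auto
      then show False using ZF(3) dependent_finite[OF finZ] by blast
    qed
    moreover have "u x *s x = - (\<Sum>v\<in>Z. u v *s v)" using sum0 by (rule eq_neg_iff_add_eq_0[THEN iffD2])
    then have "u x *s x \<in> span Z" by (auto intro: span_neg span_sum span_scale span_base)
    ultimately show ?thesis by blast
  qed
  then obtain c where c: "\<And>x. x \<in> S \<Longrightarrow> c x \<noteq> 0" "\<And>x. x \<in> S \<Longrightarrow> c x *s x \<in> span Z" by metis
  define d where "d = prod c S"
  have d: "d \<noteq> 0" using S(1) c(1) by (simp add: d_def)
  have dspan: "d *s m \<in> span Z" for m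
  proof -
    have "m \<in> span S" using S(2) by simp
    then show ?thesis
    proof (rule span_induct)
      show "subspace {m. d *s m \<in> span Z}"
      proof (rule subspaceI; clarify)
        show "d *s 0 \<in> span Z" by (simp add: span_zero)
        show "d *s (x + y) \<in> span Z" if "d *s x \<in> span Z" "d *s y \<in> span Z" for x y
          using that by (simp add: scale_right_distrib span_add)
        show "d *s k *s x \<in> span Z" if "d *s x \<in> span Z" for k x
          using span_scale[OF that, of k] by (simp only: scale_left_commute[of d])
      qed
      fix x assume x: "x \<in> S"
      then have "c x dvd d" unfolding d_def using S(1) by (simp add: dvd_prodI)
      then obtain k where "d = k * c x" by (auto simp: dvd_def mult.commute)
      then have "d *s x = k *s c x *s x" by simp
      then show "d *s x \<in> span Z" using span_scale[OF c(2)[OF x], of k] by simp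
    qed
  qed
  define \<phi> where "\<phi> z m = representation Z (d *s m) z" for z m
  show ?thesis
  proof (rule that[OF ZF(1) finZ d])
    show "functional (\<phi> z)" if "z \<in> Z" for z
      by (rule functionalI)
        (simp_all add: \<phi>_def scale_right_distrib representation_add[OF ZF(3) dspan dspan]
          scale_left_commute[of d] representation_scale[OF ZF(3) dspan] del: scale_scale)
    show "\<phi> z z' = (if z = z' then d else 0)" if "z \<in> Z" "z' \<in> Z" for z z'
      using that by (simp add: \<phi>_def representation_scale[OF ZF(3) span_base] representation_basis[OF ZF(3)])
    show "d *s m = (\<Sum>z\<in>Z. \<phi> z m *s z)" for m
      unfolding \<phi>_def by (rule sum_representation_eq[OF ZF(3) dspan finZ, symmetric]) simp
  qed
qed

lemma subspace_torsion:
  assumes "subspace X"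
  shows "subspace (torsion scale X)"
proof (rule subspaceI)
  show "0 \<in> torsion scale X"
    unfolding torsion_def using subspace_0[OF assms] by (auto intro!: exI[of _ 1])
next
  fix x y assume "x \<in> torsion scale X" "y \<in> torsion scale X"
  then obtain c d where cd: "x \<in> X" "y \<in> X" "c \<noteq> 0" "d \<noteq> 0" "c *s x = 0" "d *s y = 0"
    unfolding torsion_def by blast
  have "(c * d) *s (x + y) = d *s c *s x + c *s d *s y"
    by (simp add: scale_right_distrib mult.commute)
  then have "(c * d) *s (x + y) = 0" by (simp only: cd scale_zero_right add_0)
  moreover have "x + y \<in> X" "c * d \<noteq> 0" using cd subspace_add[OF assms] by auto
  ultimately show "x + y \<in> torsion scale X" unfolding torsion_def by blast
next
  fix k x assume "x \<in> torsion scale X"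
  then obtain c where c: "x \<in> X" "c \<noteq> 0" "c *s x = 0" unfolding torsion_def by blast
  have "c *s k *s x = k *s c *s x" by (rule scale_left_commute)
  then have "c *s k *s x = 0" by (simp only: c scale_zero_right)
  then show "k *s x \<in> torsion scale X"
    unfolding torsion_def using c subspace_scale[OF assms] by blast
qed

lemma functional_torsion:
  assumes "functional \<phi>" "m \<in> torsion scale X"
  shows "\<phi> m = 0"
proof -
  interpret \<phi>: module_hom scale "(*)" \<phi> by fact
  obtain d where "d \<noteq> 0" "d *s m = 0" using assms(2) unfolding torsion_def by blast
  then show ?thesis using \<phi>.scale[of d m] \<phi>.zero by simp
qed

text \<open>The coordinate functionals serve: if all of them vanish at \<open>m\<close>, then
  \<open>d\<close> annihilates \<open>m\<close>.\<close>

lemma finitely_generated_torsion: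
  assumes "finitely_generated scale"
  obtains \<Phi> where "finite \<Phi>" "\<And>\<phi>. \<phi> \<in> \<Phi> \<Longrightarrow> functional \<phi>"
    "torsion scale UNIV = {m. \<forall>\<phi>\<in>\<Phi>. \<phi> m = 0}"
proof -
  obtain Z d \<phi> where Z: "finite Z" "d \<noteq> 0" "\<And>z. z \<in> Z \<Longrightarrow> functional (\<phi> z)"
    "\<And>m. d *s m = (\<Sum>z\<in>Z. \<phi> z m *s z)"
    using finitely_generated_coordinates[OF assms finite.emptyI independent_empty] by metis
  have "m \<in> torsion scale UNIV" if "\<forall>z\<in>Z. \<phi> z m = 0" for m
  proof -
    have "d *s m = 0" using that by (simp add: Z(4))
    then show ?thesis unfolding torsion_def using Z(2) by blast
  qed
  then have "torsion scale UNIV = {m. \<forall>\<phi>\<in>\<phi> ` Z. \<phi> m = 0}"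
    using functional_torsion Z(3) by auto
  then show ?thesis using Z(1,3) by (intro that[of "\<phi> ` Z"]) auto
qed

lemma nontorsion_functional:
  assumes "finitely_generated scale" "m \<notin> torsion scale UNIV"
  obtains \<phi> where "functional \<phi>" "\<phi> m \<noteq> 0"
proof -
  obtain \<Phi> where \<Phi>: "finite \<Phi>" "\<And>\<phi>. \<phi> \<in> \<Phi> \<Longrightarrow> functional \<phi>"
    "torsion scale UNIV = {m. \<forall>\<phi>\<in>\<Phi>. \<phi> m = 0}"
    by (rule finitely_generated_torsion[OF assms(1)]) (rule that)
  then obtain \<phi> where "\<phi> \<in> \<Phi>" "\<phi> m \<noteq> 0" using assms(2) by blast
  then show ?thesis using \<Phi>(2) that by blast
qed

lemma torsion_direct_sum:
  assumes ded: "dedekind_domain TYPE('a)" and fg: "finitely_generated scale"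
  shows "\<exists>P. direct_sum scale UNIV P (torsion scale UNIV)"
proof -
  obtain \<Phi> where \<Phi>: "finite \<Phi>" "\<And>\<phi>. \<phi> \<in> \<Phi> \<Longrightarrow> functional \<phi>"
    "torsion scale UNIV = {m. \<forall>\<phi>\<in>\<Phi>. \<phi> m = 0}"
    by (rule finitely_generated_torsion[OF fg]) (rule that)
  from \<Phi>(1,2) have "\<exists>P. direct_sum scale UNIV P {m. \<forall>\<phi>\<in>\<Phi>. \<phi> m = 0}"
  proof (induction rule: finite_induct)
    case empty
    have "direct_sum scale UNIV {0} UNIV" by (rule direct_sumI) auto
    then show ?case by auto
  next
    case (insert \<psi> \<Phi>)
    let ?X = "{m. \<forall>\<phi>\<in>\<Phi>. \<phi> m = 0}"
    obtain P where P: "direct_sum scale UNIV P ?X" using insert by auto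
    have \<psi>: "functional \<psi>" using insert.prems by simp
    \<comment> \<open>\<open>\<psi>\<close> is split on the common kernel of \<open>\<Phi>\<close>,
      not on the whole module, so that the new piece \<open>J\<close> can be added to
      \<open>P\<close>.\<close>
    obtain J where "direct_sum scale ?X J {x \<in> ?X. \<psi> x = 0}"
      by (rule functional_splits[OF ded \<psi> direct_sumD(2)[OF P]]) (rule that)
    then have "direct_sum scale UNIV (sum_sets P J) {x \<in> ?X. \<psi> x = 0}"
      by (rule direct_sum_assoc[OF P])
    moreover have "{x \<in> ?X. \<psi> x = 0} = {m. \<forall>\<phi>\<in>insert \<psi> \<Phi>. \<phi> m = 0}" by auto
    ultimately show ?case by auto
  qed
  then show ?thesis by (simp add: \<Phi>(3))
qed

section \<open>Independent pairs and unimodular functionals\<close>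

text \<open>Stated for two elements and not for the set \<open>{x, y}\<close>, which for
  \<open>x = y\<close> collapses to a singleton that may well be independent.\<close>

definition independent_pair :: "'b \<Rightarrow> 'b \<Rightarrow> bool"
  where "independent_pair x y \<longleftrightarrow> (\<forall>a b. a *s x + b *s y = 0 \<longrightarrow> a = 0 \<and> b = 0)"

lemma independent_pairD: "independent_pair x y \<Longrightarrow> a *s x + b *s y = 0 \<Longrightarrow> a = 0 \<and> b = 0"
  by (simp add: independent_pair_def)

lemma independent_pair_nontorsion: "independent_pair x y \<Longrightarrow> x \<notin> torsion scale X"
  using independent_pairD[of x y _ 0] by (auto simp: torsion_def)

text \<open>If \<open>\<phi> x = 0\<close>, then \<open>x\<close> serves. Otherwise the combination
  \<open>\<phi> y *s x + (- \<phi> x) *s y\<close> lies in the kernel, and independence makes it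
  nontorsion.\<close>

lemma independent_pair_kernel:
  assumes xy: "independent_pair x y" and \<phi>: "functional \<phi>"
  obtains z where "\<phi> z = 0" "z \<notin> torsion scale UNIV"
proof (cases "\<phi> x = 0")
  case True
  then show ?thesis using that independent_pair_nontorsion[OF xy] by blast
next
  case False
  interpret \<phi>: module_hom scale "(*)" \<phi> by fact
  define z where "z = \<phi> y *s x + (- \<phi> x) *s y"
  have "z \<notin> torsion scale UNIV"
  proof
    assume "z \<in> torsion scale UNIV"
    then obtain c where c: "c \<noteq> 0" "c *s z = 0" unfolding torsion_def by blast
    have "(c * \<phi> y) *s x + (c * - \<phi> x) *s y = c *s z"
      by (simp only: z_def scale_right_distrib scale_scale)
    then have "c * - \<phi> x = 0" using c(2) independent_pairD[OF xy] by metis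
    then show False using c(1) False by simp
  qed
  moreover have "\<phi> z = 0" by (simp add: z_def \<phi>.add \<phi>.scale mult.commute del: scale_minus_left)
  ultimately show ?thesis using that by blast
qed

text \<open>The functionals to which \<open>comaximal_functional\<close> applies are those that agree on \<open>ker \<phi>\<close> with a
  functional \<open>\<chi>\<close> not vanishing there; \<open>\<chi> (ker \<phi>)\<close> is then contained in the image of each of them.\<close>

lemma unimodular_functional:
  assumes ded: "dedekind_domain TYPE('a)" and fg: "finitely_generated scale"
    and xy: "independent_pair x y"
  obtains \<psi> e where "functional \<psi>" "\<psi> e = 1"
proof -
  obtain \<phi> where \<phi>: "functional \<phi>" "\<phi> x \<noteq> 0"
    by (rule nontorsion_functional[OF fg independent_pair_nontorsion[OF xy]]) (rule that)
  obtain z where z: "\<phi> z = 0" "z \<notin> torsion scale UNIV" by (rule independent_pair_kernel[OF xy \<phi>(1)]) (rule that)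
  obtain \<chi> where \<chi>: "functional \<chi>" "\<chi> z \<noteq> 0" by (rule nontorsion_functional[OF fg z(2)]) (rule that)
  interpret \<phi>: module_hom scale "(*)" \<phi> by fact
  interpret \<chi>: module_hom scale "(*)" \<chi> by fact
  define I where "I = \<chi> ` {m. \<phi> m = 0}"
  have I: "is_ideal I" unfolding I_def by (rule \<chi>.subspace_image[OF \<phi>.subspace_kernel])
  have "\<chi> z \<in> I" unfolding I_def using z(1) by blast
  then have I0: "I \<noteq> {0}" using \<chi>(2) by blast
  define \<Psi> where "\<Psi> = {\<psi>. functional \<psi> \<and> (\<forall>m. \<phi> m = 0 \<longrightarrow> \<psi> m = \<chi> m)}"
  have "\<exists>\<psi>\<in>\<Psi>. \<exists>x. 1 - \<psi> x \<in> I"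
  proof (rule comaximal_functional[where s = scale, OF ded I I0])
    have "\<chi> \<in> \<Psi>" using \<chi>(1) by (simp add: \<Psi>_def)
    then show "\<Psi> \<noteq> {}" by blast
    show "\<psi> (x + y) = \<psi> x + \<psi> y" if "\<psi> \<in> \<Psi>" for \<psi> x y
      using that by (simp add: \<Psi>_def module_hom_iff)
    show "\<psi> (d *s x) = d * \<psi> x" if "\<psi> \<in> \<Psi>" for \<psi> d x
      using that by (simp add: \<Psi>_def module_hom_iff)
    show "(\<lambda>x. p * \<psi> x + (1 - p) * \<upsilon> x) \<in> \<Psi>" if "\<psi> \<in> \<Psi>" "\<upsilon> \<in> \<Psi>" for \<psi> \<upsilon> p
    proof -
      have "(p * c + (1 - p) * c) = c" for c by (simp add: algebra_simps)
      moreover have "functional (\<lambda>x. p * \<psi> x + (1 - p) * \<upsilon> x)"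
        by (rule functionalI) (use that in \<open>simp_all add: \<Psi>_def module_hom_iff algebra_simps\<close>)
      ultimately show ?thesis using that by (simp add: \<Psi>_def)
    qed
    fix P :: "'a set" assume max: "maximal_ideal P"
    then have P: "is_ideal P" "P \<noteq> UNIV" by (simp_all add: maximal_ideal_def)
    then have P1: "1 \<notin> P" using ideal_eq_UNIV_iff by blast
    show "\<exists>\<psi>\<in>\<Psi>. \<exists>x. \<psi> x \<notin> P"
    proof (cases "\<exists>x. \<chi> x \<notin> P")
      case True
      then show ?thesis using \<open>\<chi> \<in> \<Psi>\<close> by blast
    next
      case False
      \<comment> \<open>All values of \<open>\<chi>\<close> lie in \<open>P\<close>. The correction
        is \<open>w = y \<phi>\<close> with \<open>y\<close> in the inverse of \<open>L\<close>: it
        is \<open>D\<close>-valued, vanishes on \<open>ker \<phi>\<close>, and for a suitable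
        \<open>y\<close> takes a value outside \<open>P\<close>.\<close>
      define L where "L = range \<phi>"
      have L: "is_ideal L" unfolding L_def by (rule \<phi>.subspace_image[OF subspace_UNIV])
      have "L \<noteq> {0}" unfolding L_def using \<phi>(2) by blast
      then have "invertible_ideal L" by (rule dedekind_invertible[OF ded L])
      then have one: "1 \<in> fract.span {to_fract a * y |a y. a \<in> L \<and> y \<in> inverse_ideal L}"
        unfolding invertible_ideal_def by (metis rangeI to_fract_1)
      \<comment> \<open>If all products lay in \<open>P\<close>, so would the module they generate,
        which contains 1.\<close>
      have "\<exists>a y. a \<in> L \<and> y \<in> inverse_ideal L \<and> to_fract a * y \<notin> to_fract ` P"
      proof (rule ccontr)
        assume "\<nexists>a y. a \<in> L \<and> y \<in> inverse_ideal L \<and> to_fract a * y \<notin> to_fract ` P"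
        then have "{to_fract a * y |a y. a \<in> L \<and> y \<in> inverse_ideal L} \<subseteq> to_fract ` P" by auto
        moreover have "fract.subspace (to_fract ` P)"
        proof (rule fract.subspaceI)
          show "0 \<in> to_fract ` P" using ideal.subspace_0[OF P(1)] by (metis image_eqI to_fract_0)
          show "x + y \<in> to_fract ` P" if "x \<in> to_fract ` P" "y \<in> to_fract ` P" for x y
            using that ideal.subspace_add[OF P(1)] by (auto simp flip: to_fract_add)
          show "to_fract c * x \<in> to_fract ` P" if "x \<in> to_fract ` P" for c x
            using that ideal.subspace_scale[OF P(1)] by (auto simp flip: to_fract_mult)
        qed
        ultimately have "1 \<in> to_fract ` P" using one fract.span_minimal by blast
        then obtain p where "p \<in> P" "to_fract p = to_fract 1" by (metis imageE to_fract_1)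
        then show False using P1 by (simp only: to_fract_eq_iff)
      qed
      then obtain a y where ay: "a \<in> L" "y \<in> inverse_ideal L" "to_fract a * y \<notin> to_fract ` P" by blast
      have "\<forall>m. \<exists>c. to_fract (\<phi> m) * y = to_fract c" using ay(2) unfolding inverse_ideal_def L_def by blast
      then obtain w where w: "\<And>m. to_fract (\<phi> m) * y = to_fract (w m)" by metis
      have "to_fract (w (m + n)) = to_fract (w m + w n)" for m n
        by (simp add: w[symmetric] \<phi>.add distrib_right)
      then have w_add: "w (m + n) = w m + w n" for m n by (simp only: to_fract_eq_iff)
      have "to_fract (w (c *s m)) = to_fract (c * w m)" for c m
        by (simp add: w[symmetric] \<phi>.scale mult.assoc)
      then have w_scale: "w (c *s m) = c * w m" for c m by (simp only: to_fract_eq_iff)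
      have w0: "w m = 0" if "\<phi> m = 0" for m using w[of m] that by simp
      have "functional (\<lambda>m. \<chi> m + w m)"
        by (rule functionalI) (simp_all add: \<chi>.add \<chi>.scale w_add w_scale distrib_left)
      then have \<psi>: "(\<lambda>m. \<chi> m + w m) \<in> \<Psi>" using w0 by (simp add: \<Psi>_def)
      obtain m where "a = \<phi> m" using ay(1) unfolding L_def by blast
      then have "w m \<notin> P" using ay(3) w[of m] by auto
      moreover have "\<chi> m \<in> P" using False by blast
      moreover have "w m = (\<chi> m + w m) - \<chi> m" by simp
      ultimately have "\<chi> m + w m \<notin> P" using ideal.subspace_diff[OF P(1)] by metis
      then show ?thesis by (intro bexI[OF exI[of _ m] \<psi>])
    qed
  qed
  then obtain \<psi> v where \<psi>: "\<psi> \<in> \<Psi>" "1 - \<psi> v \<in> I" by blast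
  \<comment> \<open>The remaining error is \<open>\<chi> k\<close> with \<open>\<phi> k = 0\<close>.
    There \<open>\<psi>\<close> agrees with \<open>\<chi>\<close>, so adding \<open>k\<close> to
    \<open>v\<close> removes it exactly.\<close>
  then obtain k where k: "\<phi> k = 0" "1 - \<psi> v = \<chi> k" unfolding I_def by blast
  have hom: "functional \<psi>" and \<psi>k: "\<psi> k = \<chi> k" using \<psi>(1) k(1) by (auto simp: \<Psi>_def)
  have "\<psi> (v + k) = \<psi> v + \<psi> k" by (rule module_hom.add[OF hom])
  also have "\<dots> = 1" unfolding \<psi>k k(2)[symmetric] by simp
  finally have "\<psi> (v + k) = 1" .
  then show ?thesis using that hom by blast
qed

end

section \<open>Rank\<close>

global_interpretation free: vector_space "free_scale :: 'k::field \<Rightarrow> ('b \<Rightarrow>\<^sub>0 'k) \<Rightarrow> 'b \<Rightarrow>\<^sub>0 'k"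
  by (rule vector_space_free_scale)

section \<open>Extending functionals to the fraction field\<close>

text \<open>The \<open>K\<close>-linear map with \<open>1 \<otimes> x \<mapsto> \<phi> x\<close>.
  For a functional \<open>\<phi>\<close> it kills the tensor relations, so it represents the induced
  map \<open>K \<otimes> M \<rightarrow> K\<close>.\<close>

definition linear_extension :: "('b \<Rightarrow> 'a::idom) \<Rightarrow> ('b \<Rightarrow>\<^sub>0 'a fract) \<Rightarrow> 'a fract"
  where "linear_extension \<phi> v = (\<Sum>x\<in>Poly_Mapping.keys v. Poly_Mapping.lookup v x * to_fract (\<phi> x))"

lemma linear_extension_superset:
  assumes "finite A" "Poly_Mapping.keys v \<subseteq> A"
  shows "linear_extension \<phi> v = (\<Sum>x\<in>A. Poly_Mapping.lookup v x * to_fract (\<phi> x))"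
  unfolding linear_extension_def using assms
  by (intro sum.mono_neutral_left) (auto simp: in_keys_iff)

lemma linear_extension_add: "linear_extension \<phi> (u + v) = linear_extension \<phi> u + linear_extension \<phi> v"
proof -
  let ?A = "Poly_Mapping.keys u \<union> Poly_Mapping.keys v"
  have "Poly_Mapping.keys (u + v) \<subseteq> ?A" by (rule keys_add)
  then show ?thesis
    by (simp add: linear_extension_superset[of ?A] lookup_add distrib_right sum.distrib)
qed

lemma linear_extension_free_scale: "linear_extension \<phi> (free_scale c v) = c * linear_extension \<phi> v"
proof -
  have "Poly_Mapping.keys (free_scale c v) \<subseteq> Poly_Mapping.keys v" by (auto simp: in_keys_iff lookup_free_scale)
  then show ?thesis
    by (simp add: linear_extension_superset[of "Poly_Mapping.keys v"] lookup_free_scale sum_distrib_left mult.assoc)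
qed

lemma linear_extension_single: "linear_extension \<phi> (Poly_Mapping.single x k) = k * to_fract (\<phi> x)"
  by (simp add: linear_extension_superset[of "{x}"])

lemma module_hom_linear_extension: "module_hom free_scale (*) (linear_extension \<phi>)"
  unfolding module_hom_iff
  using free.module_axioms ideal.module_axioms linear_extension_add linear_extension_free_scale by blast

lemma free_span_single: "free.span (range (\<lambda>x. Poly_Mapping.single x 1)) = (UNIV :: ('b \<Rightarrow>\<^sub>0 'k::field) set)"
proof -
  have "v \<in> free.span (range (\<lambda>x. Poly_Mapping.single x 1))" for v :: "'b \<Rightarrow>\<^sub>0 'k"
  proof -
    have "v = (\<Sum>x\<in>Poly_Mapping.keys v. free_scale (Poly_Mapping.lookup v x) (Poly_Mapping.single x 1))"
      by (rule poly_mapping_eqI) (simp add: lookup_sum lookup_free_scale lookup_single when_def in_keys_iff if_distrib[of "(*) _"] cong: if_cong)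
    also have "\<dots> \<in> free.span (range (\<lambda>x. Poly_Mapping.single x 1))"
      by (intro free.span_sum free.span_scale free.span_base) simp
    finally show ?thesis .
  qed
  then show ?thesis by blast
qed

text \<open>A linear map \<open>L\<close> with kernel \<open>W\<close> identifies the quotient by \<open>W\<close> with the subspace \<open>range L\<close>.\<close>

lemma quotient_basis_card:
  fixes L :: "('b \<Rightarrow>\<^sub>0 'k::field) \<Rightarrow> ('b \<Rightarrow>\<^sub>0 'k)"
  assumes L: "module_hom free_scale free_scale L" and ker: "\<And>v. L v = 0 \<longleftrightarrow> v \<in> W"
    and B: "quotient_basis free_scale W B"
  shows "card B = free.dim (range L)"
proof -
  interpret L: module_hom free_scale free_scale L by fact
  have ind: "c b = 0" if "finite S" "S \<subseteq> B" "(\<Sum>b\<in>S. free_scale (c b) b) \<in> W" "b \<in> S" for S c b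
    using B that unfolding quotient_basis_def by blast
  have inj: "inj_on L B"
  proof (rule inj_onI, rule ccontr)
    fix b b' assume b: "b \<in> B" "b' \<in> B" "L b = L b'" "b \<noteq> b'"
    \<comment> \<open>These are the coefficients of \<open>b - b'\<close>, which lies in
      \<open>W\<close>; independence would force the coefficient 1 of \<open>b\<close> to be
      0.\<close>
    let ?c = "\<lambda>x. if x = b then 1 else - 1 :: 'k"
    have "(\<Sum>x\<in>{b, b'}. free_scale (?c x) x) = b - b'" using b(4) by simp
    also have "\<dots> \<in> W" using b(3) by (simp add: L.diff flip: ker)
    finally have "?c b = 0" using b by (intro ind[of "{b, b'}"]) auto
    then show False by simp
  qed
  have "free.independent (L ` B)"
    unfolding free.dependent_explicit
  proof (safe, rule ccontr)
    fix t u v assume t: "finite t" "t \<subseteq> L ` B" "(\<Sum>v\<in>t. free_scale (u v) v) = 0" "v \<in> t" "u v \<noteq> 0"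
    obtain S where S: "S \<subseteq> B" "finite S" "t = L ` S" using finite_subset_image[OF t(1,2)] by blast
    have "(\<Sum>v\<in>t. free_scale (u v) v) = (\<Sum>b\<in>S. free_scale (u (L b)) (L b))"
      unfolding S(3) using inj_on_subset[OF inj S(1)] by (simp add: sum.reindex)
    also have "\<dots> = L (\<Sum>b\<in>S. free_scale (u (L b)) b)" by (simp add: L.sum L.scale)
    finally have "(\<Sum>b\<in>S. free_scale (u (L b)) b) \<in> W" using t(3) ker by simp
    moreover obtain b where "b \<in> S" "v = L b" using t(4) S(3) by blast
    ultimately have "u v = 0" using ind[OF S(2,1), of "\<lambda>b. u (L b)"] by simp
    then show False using t(5) by simp
  qed
  moreover have "free.span (L ` B) = free.span (range L)"
  proof
    show "free.span (L ` B) \<subseteq> free.span (range L)" by (rule free.span_mono) blast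
    have "L v \<in> free.span (L ` B)" for v
    proof -
      have "v \<in> free.span (W \<union> B)" using B by (simp add: quotient_basis_def)
      then show ?thesis
      proof (induction rule: free.span_induct_alt)
        case base
        show ?case by (simp add: L.zero free.span_zero)
      next
        case (step c x y)
        from step(1) have "L x \<in> free.span (L ` B)"
        proof
          assume "x \<in> W"
          then show ?thesis using ker[of x] by (simp add: free.span_zero)
        qed (simp add: free.span_base)
        then show ?case using step by (simp add: L.add L.scale free.span_add free.span_scale)
      qed
    qed
    then show "free.span (range L) \<subseteq> free.span (L ` B)" by (intro free.span_minimal) auto
  qed
  ultimately have "free.dim (range L) = card (L ` B)" by (intro free.dim_eq_card)
  then show ?thesis using inj by (simp add: card_image)
qed

section \<open>Computing the rank from coordinates\<close>

context idom_module
begin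

abbreviation tensor :: "'b \<Rightarrow> 'b \<Rightarrow>\<^sub>0 'a fract"
  where "tensor x \<equiv> Poly_Mapping.single x 1"

lemma tensor_relations_add: "tensor (x + y) - (tensor x + tensor y) \<in> tensor_relations scale"
  unfolding tensor_relations_def by (intro free.span_base) blast

lemma tensor_relations_scale:
  "tensor (d *s x) - free_scale (to_fract d) (tensor x) \<in> tensor_relations scale"
  unfolding tensor_relations_def by (intro free.span_base) blast

lemma subspace_tensor_relations: "free.subspace (tensor_relations scale)"
  unfolding tensor_relations_def by (rule free.subspace_span)

lemma tensor_relations_sum:
  assumes "finite A"
  shows "tensor (\<Sum>z\<in>A. a z *s z) - (\<Sum>z\<in>A. free_scale (to_fract (a z)) (tensor z)) \<in> tensor_relations scale"
  using assms
proof (induction rule: finite_induct)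
  case empty
  \<comment> \<open>\<open>tensor 0\<close> is a relation, namely the negative of the additivity
    relation for \<open>0 + 0\<close>.\<close>
  have "- (tensor (0 + 0) - (tensor 0 + tensor 0)) \<in> tensor_relations scale"
    by (intro free.subspace_neg subspace_tensor_relations tensor_relations_add)
  then show ?case by simp
next
  case (insert x A)
  let ?s = "\<Sum>z\<in>A. a z *s z" and ?t = "\<Sum>z\<in>A. free_scale (to_fract (a z)) (tensor z)"
  have "(tensor (a x *s x + ?s) - (tensor (a x *s x) + tensor ?s)) +
      ((tensor (a x *s x) - free_scale (to_fract (a x)) (tensor x)) + (tensor ?s - ?t)) \<in> tensor_relations scale"
    by (intro free.subspace_add subspace_tensor_relations tensor_relations_add tensor_relations_scale insert.IH)
  then show ?case using insert.hyps by (simp add: algebra_simps)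
qed

lemma linear_extension_tensor_relations:
  assumes "functional \<phi>" "v \<in> tensor_relations scale"
  shows "linear_extension \<phi> v = 0"
proof -
  interpret \<phi>: module_hom scale "(*)" \<phi> by fact
  interpret E: module_hom free_scale "(*)" "linear_extension \<phi>" by (rule module_hom_linear_extension)
  have "tensor_relations scale \<subseteq> {v. linear_extension \<phi> v = 0}"
    unfolding tensor_relations_def
    by (rule free.span_minimal[OF _ E.subspace_kernel])
      (auto simp: E.diff E.add E.scale linear_extension_single \<phi>.add \<phi>.scale)
  then show ?thesis using assms(2) by blast
qed

text \<open>\<open>L\<close> replaces \<open>1 \<otimes> x\<close> by its expansion in the symbols
  of \<open>Z\<close>. Since \<open>v\<close> and \<open>L v\<close> represent the same element of
  \<open>K \<otimes> M\<close> and \<open>L\<close> kills the relations, its kernel is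
  \<open>tensor_relations scale\<close>. By \<open>quotient_basis_card\<close> all quotient bases
  then have the same cardinality, which settles the choice made by \<open>SOME\<close>.\<close>

lemma module_rank_eq_card:
  assumes Z: "finite Z" "d \<noteq> 0" "\<And>z. z \<in> Z \<Longrightarrow> functional (\<phi> z)"
    "\<And>z z'. z \<in> Z \<Longrightarrow> z' \<in> Z \<Longrightarrow> \<phi> z z' = (if z = z' then d else 0)"
    "\<And>m. d *s m = (\<Sum>z\<in>Z. \<phi> z m *s z)"
  shows "module_rank scale = card Z"
proof -
  let ?W = "tensor_relations scale"
  \<comment> \<open>The functionals return \<open>d\<close> times the coordinates, hence the
    division.\<close>
  define L where "L v = (\<Sum>z\<in>Z. free_scale (linear_extension (\<phi> z) v / to_fract d) (tensor z))" for v
  have L: "module_hom free_scale free_scale L"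
    unfolding module_hom_iff
  proof (intro conjI allI free.module_axioms)
    show "L (u + v) = L u + L v" for u v
      by (simp add: L_def linear_extension_add add_divide_distrib free.scale_left_distrib sum.distrib)
    show "L (free_scale c v) = free_scale c (L v)" for c v
      by (simp add: L_def linear_extension_free_scale free.scale_sum_right)
  qed
  interpret L: module_hom free_scale free_scale L by fact
  have d: "to_fract d \<noteq> 0" using Z(2) by simp
  have proj: "v - L v \<in> ?W" for v
  proof -
    have "v \<in> free.span (range tensor)" by (simp add: free_span_single)
    then show ?thesis
    proof (rule free.span_induct)
      show "free.subspace {v. v - L v \<in> ?W}"
      proof (rule free.subspaceI; clarify)
        show "0 - L 0 \<in> ?W" using free.subspace_0[OF subspace_tensor_relations] by (simp add: L.zero)
        show "u + v - L (u + v) \<in> ?W" if "u - L u \<in> ?W" "v - L v \<in> ?W" for u v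
          using free.subspace_add[OF subspace_tensor_relations that] by (simp add: L.add algebra_simps)
        show "free_scale c v - L (free_scale c v) \<in> ?W" if "v - L v \<in> ?W" for c v
          using free.subspace_scale[OF subspace_tensor_relations that, of c]
          by (simp add: L.scale free.scale_right_diff_distrib)
      qed
      fix v assume "v \<in> range tensor"
      then obtain x where x: "v = tensor x" by blast
      let ?t = "\<Sum>z\<in>Z. free_scale (to_fract (\<phi> z x)) (tensor z)"
      have "tensor (d *s x) - ?t \<in> ?W" using tensor_relations_sum[OF Z(1)] by (simp add: Z(5))
      from free.subspace_diff[OF subspace_tensor_relations this tensor_relations_scale[of d x]]
      have "free_scale (to_fract d) (tensor x) - ?t \<in> ?W" by simp
      from free.subspace_scale[OF subspace_tensor_relations this, of "1 / to_fract d"]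
      have "tensor x - free_scale (1 / to_fract d) ?t \<in> ?W"
        using d by (simp add: free.scale_right_diff_distrib)
      moreover have "free_scale (1 / to_fract d) ?t = L v"
        by (simp add: L_def x linear_extension_single free.scale_sum_right)
      ultimately show "v - L v \<in> ?W" by (simp add: x)
    qed
  qed
  have ker: "L v = 0 \<longleftrightarrow> v \<in> ?W" for v
  proof
    show "v \<in> ?W" if "L v = 0" using proj[of v] that by simp
    show "L v = 0" if "v \<in> ?W" using that Z(3) by (simp add: L_def linear_extension_tensor_relations)
  qed
  have coord: "linear_extension (\<phi> z) (tensor z') = (if z = z' then to_fract d else 0)"
    if "z \<in> Z" "z' \<in> Z" for z z'
    using Z(4)[OF that] by (simp add: linear_extension_single)
  have inj: "inj_on tensor Z" by (auto simp: inj_on_def poly_mapping_eq_iff fun_eq_iff lookup_single when_def split: if_splits)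
  have basis: "quotient_basis free_scale ?W (tensor ` Z)"
    unfolding quotient_basis_def
  proof (intro conjI allI impI ballI)
    fix S c b assume S: "finite S \<and> S \<subseteq> tensor ` Z \<and> (\<Sum>b\<in>S. free_scale (c b) b) \<in> ?W" and b: "b \<in> S"
    obtain z where z: "z \<in> Z" "b = tensor z" using S b by blast
    interpret E: module_hom free_scale "(*)" "linear_extension (\<phi> z)" by (rule module_hom_linear_extension)
    have "0 = linear_extension (\<phi> z) (\<Sum>b\<in>S. free_scale (c b) b)"
      using S Z(3)[OF z(1)] by (simp add: linear_extension_tensor_relations)
    also have "\<dots> = (\<Sum>x\<in>S. c x * linear_extension (\<phi> z) x)" by (simp add: E.sum E.scale)
    also have "\<dots> = (\<Sum>x\<in>S. if x = b then c b * to_fract d else 0)"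
    proof (rule sum.cong[OF refl])
      fix x assume "x \<in> S"
      then obtain z' where "z' \<in> Z" "x = tensor z'" using S by blast
      then show "c x * linear_extension (\<phi> z) x = (if x = b then c b * to_fract d else 0)"
        using coord[OF z(1)] z inj by (auto dest: inj_onD)
    qed
    also have "\<dots> = c b * to_fract d" using S b by simp
    finally show "c b = 0" using d by simp
  next
    have "v \<in> free.span (?W \<union> tensor ` Z)" for v
    proof -
      have "v - L v \<in> free.span (?W \<union> tensor ` Z)" using proj by (simp add: free.span_base)
      moreover have "L v \<in> free.span (?W \<union> tensor ` Z)"
        unfolding L_def by (intro free.span_sum free.span_scale free.span_base) simp
      ultimately have "(v - L v) + L v \<in> free.span (?W \<union> tensor ` Z)" by (rule free.span_add)
      then show ?thesis by simp
    qed
    then show "free.span (?W \<union> tensor ` Z) = UNIV" by blast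
  qed
  then have "quotient_basis free_scale ?W (SOME B. quotient_basis free_scale ?W B)" by (rule someI)
  then have "module_rank scale = free.dim (range L)"
    unfolding module_rank_def quotient_dim_def by (rule quotient_basis_card[OF L ker])
  also have "\<dots> = card (tensor ` Z)" by (rule quotient_basis_card[OF L ker basis, symmetric])
  also have "\<dots> = card Z" using inj by (rule card_image)
  finally show ?thesis .
qed

text \<open>Two elements of a coordinate set are independent by evaluating their coordinate
  functionals; conversely an independent pair extends to a coordinate set.\<close>

lemma module_rank_ge_2_iff:
  assumes fg: "finitely_generated scale"
  shows "2 \<le> module_rank scale \<longleftrightarrow> (\<exists>x y. independent_pair x y)"
proof
  assume rank: "2 \<le> module_rank scale"
  obtain Z d \<phi> where Z: "finite Z" "d \<noteq> 0" "\<And>z. z \<in> Z \<Longrightarrow> functional (\<phi> z)"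
    "\<And>z z'. z \<in> Z \<Longrightarrow> z' \<in> Z \<Longrightarrow> \<phi> z z' = (if z = z' then d else 0)"
    "\<And>m. d *s m = (\<Sum>z\<in>Z. \<phi> z m *s z)"
    by (rule finitely_generated_coordinates[OF fg finite.emptyI independent_empty]) (rule that)
  have "2 \<le> card Z" using rank module_rank_eq_card[OF Z] by simp
  then obtain x y where xy: "x \<in> Z" "y \<in> Z" "x \<noteq> y" by (auto simp: card_le_Suc_iff numeral_2_eq_2)
  have "independent_pair x y"
    unfolding independent_pair_def
  proof (intro allI impI)
    fix a b assume ab: "a *s x + b *s y = 0"
    have "a * \<phi> z x + b * \<phi> z y = 0" if "z \<in> Z" for z
    proof -
      interpret \<phi>: module_hom scale "(*)" "\<phi> z" by (rule Z(3)[OF that])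
      have "\<phi> z (a *s x + b *s y) = 0" by (simp only: ab \<phi>.zero)
      then show ?thesis by (simp only: \<phi>.add \<phi>.scale)
    qed
    from this[OF xy(1)] this[OF xy(2)] show "a = 0 \<and> b = 0" using Z(2) Z(4) xy by auto
  qed
  then show "\<exists>x y. independent_pair x y" by blast
next
  assume "\<exists>x y. independent_pair x y"
  then obtain x y where xy: "independent_pair x y" by blast
  have "x \<noteq> y" using independent_pairD[OF xy, of 1 "-1"] by auto
  have fin: "finite {x, y}" by simp
  have ind: "independent {x, y}"
    using \<open>x \<noteq> y\<close> by (auto simp: dependent_finite dest!: independent_pairD[OF xy])
  obtain Z d \<phi> where Z0: "{x, y} \<subseteq> Z" and Z: "finite Z" "d \<noteq> 0" "\<And>z. z \<in> Z \<Longrightarrow> functional (\<phi> z)"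
    "\<And>z z'. z \<in> Z \<Longrightarrow> z' \<in> Z \<Longrightarrow> \<phi> z z' = (if z = z' then d else 0)"
    "\<And>m. d *s m = (\<Sum>z\<in>Z. \<phi> z m *s z)"
    by (rule finitely_generated_coordinates[OF fg fin ind]) (rule that)
  have "2 \<le> card Z" using card_mono[OF Z(1) Z0] \<open>x \<noteq> y\<close> by simp
  then show "2 \<le> module_rank scale" using module_rank_eq_card[OF Z] by simp
qed

end

section \<open>C4 defects\<close>

lemma C4_defectsI:
  "direct_sum s X A B \<Longrightarrow> f \<in> hom_set s s A B \<Longrightarrow> direct_summand s {x \<in> A. f x = 0} A \<Longrightarrow>
    \<not> direct_summand s (f ` A) B \<Longrightarrow> (A, B, f) \<in> C4_defects s X"
  by (simp add: C4_defects_def)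

lemma C4_defectsD:
  assumes "(A, B, f) \<in> C4_defects s X"
  shows "direct_sum s X A B" "f \<in> hom_set s s A B" "direct_summand s {x \<in> A. f x = 0} A"
    "\<not> direct_summand s (f ` A) B"
  using assms by (simp_all add: C4_defects_def)

lemma hom_setI:
  assumes "f \<in> A \<rightarrow>\<^sub>E B" "\<And>x y. x \<in> A \<Longrightarrow> y \<in> A \<Longrightarrow> f (x + y) = f x + f y"
    "\<And>d x. x \<in> A \<Longrightarrow> f (s d x) = t d (f x)"
  shows "f \<in> hom_set s t A B"
  using assms by (simp add: hom_set_def)

lemma hom_setD:
  assumes "f \<in> hom_set s t A B"
  shows "f \<in> A \<rightarrow>\<^sub>E B" "\<And>x. x \<in> A \<Longrightarrow> f x \<in> B" "\<And>x y. x \<in> A \<Longrightarrow> y \<in> A \<Longrightarrow> f (x + y) = f x + f y"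
    "\<And>d x. x \<in> A \<Longrightarrow> f (s d x) = t d (f x)"
  using assms by (auto simp: hom_set_def)

context idom_module
begin

lemma torsion_eq_Int: "torsion scale X = X \<inter> torsion scale UNIV"
  by (auto simp: torsion_def)

lemma hom_set_zero:
  assumes "f \<in> hom_set scale scale A B" "subspace A"
  shows "f 0 = 0"
  using hom_setD(4)[OF assms(1) subspace_0[OF assms(2)], of 0] by simp

section \<open>Lifting defects of the torsion submodule\<close>

lemma direct_sum_sub:
  assumes "direct_sum scale X P T" "subspace A" "A \<subseteq> T"
  shows "direct_sum scale (sum_sets P A) P A"
  using direct_sumD[OF assms(1)] assms(2,3) subspace_0[OF assms(2)] by (auto simp: direct_sum_def)

text \<open>This evaluates the \<open>THE\<close> in \<open>lift_defect_domain\<close>; uniqueness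
  comes from \<open>P \<inter> A = {0}\<close>.\<close>

lemma direct_sum_unique_component:
  assumes PT: "direct_sum scale X P A" and pa: "p \<in> P" "a \<in> A"
  shows "(THE a'. a' \<in> A \<and> p + a - a' \<in> P) = a"
proof (rule the_equality)
  show "a \<in> A \<and> p + a - a \<in> P" using pa by simp
  fix a' assume a': "a' \<in> A \<and> p + a - a' \<in> P"
  note D = direct_sumD[OF PT]
  have "(p + a - a') - p \<in> P" by (rule subspace_diff[OF D(1)]) (use a' pa in auto)
  then have "a - a' \<in> P" by (simp add: algebra_simps)
  moreover have "a - a' \<in> A" by (rule subspace_diff[OF D(2)]) (use a' pa in auto)
  ultimately have "a - a' = 0" using D(7) by blast
  then show "a' = a" by simp
qed

lemma lift_defect_domain_apply:
  assumes "direct_sum scale X P T" "subspace A" "A \<subseteq> T" "p \<in> P" "a \<in> A"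
  shows "(\<lambda>x \<in> sum_sets P A. f (THE a. a \<in> A \<and> x - a \<in> P)) (p + a) = f a"
  using direct_sum_unique_component[OF direct_sum_sub[OF assms(1-3)] assms(4,5)] sum_setsI[OF assms(4,5)]
  by simp

text \<open>Sending \<open>P\<close> to 0 keeps the image and enlarges the kernel to
  \<open>P \<oplus> ker f\<close>, which is complemented in \<open>P \<oplus> A\<close> by the old
  complement of \<open>ker f\<close> in \<open>A\<close>.\<close>

lemma lift_defect_domain_C4:
  assumes PT: "direct_sum scale X P T" and \<delta>: "\<delta> \<in> C4_defects scale T"
  shows "lift_defect_domain P \<delta> \<in> C4_defects scale X"
proof -
  obtain A B f where \<delta>_eq: "\<delta> = (A, B, f)" by (cases \<delta>) auto
  note d = C4_defectsD[OF \<delta>[unfolded \<delta>_eq]]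
  note AB = direct_sumD[OF d(1)] and f = hom_setD[OF d(2)]
  note PA = direct_sum_sub[OF PT AB(1,4)]
  define g where "g = (\<lambda>x \<in> sum_sets P A. f (THE a. a \<in> A \<and> x - a \<in> P))"
  have g: "g (p + a) = f a" if "p \<in> P" "a \<in> A" for p a
    unfolding g_def using lift_defect_domain_apply[OF PT AB(1,4) that] .
  have "(sum_sets P A, B, g) \<in> C4_defects scale X"
  proof (rule C4_defectsI)
    show "direct_sum scale X (sum_sets P A) B" by (rule direct_sum_assoc[OF PT d(1)])
    show "g \<in> hom_set scale scale (sum_sets P A) B"
    proof (rule hom_setI)
      have "g x \<in> B" if "x \<in> sum_sets P A" for x
        using that by (rule sum_setsE) (simp add: g f(2))
      then show "g \<in> sum_sets P A \<rightarrow>\<^sub>E B" by (auto simp: g_def)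
    next
      fix x y assume "x \<in> sum_sets P A" "y \<in> sum_sets P A"
      then obtain p a q b where x: "p \<in> P" "a \<in> A" "x = p + a" and y: "q \<in> P" "b \<in> A" "y = q + b"
        by (auto elim!: sum_setsE)
      have "p + q \<in> P" "a + b \<in> A"
        using x y AB(1) direct_sumD(1)[OF PT] by (auto intro: subspace_add)
      then have "g ((p + q) + (a + b)) = f (a + b)" by (rule g)
      moreover have "x + y = (p + q) + (a + b)" using x y by (simp add: algebra_simps)
      ultimately have "g (x + y) = f (a + b)" by simp
      then show "g (x + y) = g x + g y" using g x y f(3) by simp
    next
      fix c x assume "x \<in> sum_sets P A"
      then obtain p a where x: "p \<in> P" "a \<in> A" "x = p + a" by (auto elim!: sum_setsE)
      have "c *s x = c *s p + c *s a" using x by (simp add: scale_right_distrib)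
      moreover have "c *s p \<in> P" "c *s a \<in> A"
        using x AB(1) direct_sumD(1)[OF PT] by (auto intro: subspace_scale)
      ultimately show "g (c *s x) = c *s g x" using g x f(4) by simp
    qed
    let ?K = "{x \<in> A. f x = 0}"
    obtain C where "direct_sum scale A ?K C" using d(3) by (auto simp: direct_summand_def)
    then have "direct_summand scale (sum_sets P ?K) (sum_sets P A)"
      unfolding direct_summand_def using direct_sum_assoc[OF PA] by blast
    moreover have "{x \<in> sum_sets P A. g x = 0} = sum_sets P ?K"
    proof (intro equalityI subsetI)
      fix x assume x: "x \<in> {x \<in> sum_sets P A. g x = 0}"
      then obtain p a where pa: "p \<in> P" "a \<in> A" "x = p + a" by (auto elim!: sum_setsE)
      then have "a \<in> ?K" using x g by simp
      then show "x \<in> sum_sets P ?K" using pa by (auto intro: sum_setsI)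
    next
      fix x assume "x \<in> sum_sets P ?K"
      then obtain p a where "p \<in> P" "a \<in> A" "f a = 0" "x = p + a" by (auto elim!: sum_setsE)
      then show "x \<in> {x \<in> sum_sets P A. g x = 0}" using g by (auto intro: sum_setsI)
    qed
    ultimately show "direct_summand scale {x \<in> sum_sets P A. g x = 0} (sum_sets P A)" by simp
    have "g ` sum_sets P A = f ` A"
    proof (intro equalityI subsetI)
      fix y assume "y \<in> g ` sum_sets P A"
      then obtain x where "x \<in> sum_sets P A" "y = g x" by blast
      then show "y \<in> f ` A" using g by (auto elim!: sum_setsE)
    next
      fix y assume "y \<in> f ` A"
      then obtain a where a: "a \<in> A" "y = f a" by blast
      have "0 \<in> P" using direct_sumD(1)[OF PT] by (rule subspace_0)
      then have "0 + a \<in> sum_sets P A" "y = g (0 + a)" using a by (simp_all only: sum_setsI g)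
      then show "y \<in> g ` sum_sets P A" by blast
    qed
    then show "\<not> direct_summand scale (g ` sum_sets P A) B" using d(4) by simp
  qed
  then show ?thesis by (simp add: \<delta>_eq lift_defect_domain_def g_def)
qed

text \<open>If the image were a summand of \<open>P \<oplus> B\<close>, the modular law would make
  it a summand of \<open>B\<close>.\<close>

lemma lift_defect_codomain_C4:
  assumes PT: "direct_sum scale X P T" and \<delta>: "\<delta> \<in> C4_defects scale T"
  shows "lift_defect_codomain P \<delta> \<in> C4_defects scale X"
proof -
  obtain A B f where \<delta>_eq: "\<delta> = (A, B, f)" by (cases \<delta>) auto
  note d = C4_defectsD[OF \<delta>[unfolded \<delta>_eq]]
  note AB = direct_sumD[OF d(1)] and f = hom_setD[OF d(2)]
  note PB = direct_sumD[OF direct_sum_sub[OF PT AB(2,5)]]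
  have "(A, sum_sets P B, f) \<in> C4_defects scale X"
  proof (rule C4_defectsI)
    show "direct_sum scale X A (sum_sets P B)"
      by (rule direct_sum_commute[OF direct_sum_assoc[OF PT direct_sum_commute[OF d(1)]]])
    have "f \<in> A \<rightarrow>\<^sub>E sum_sets P B" using f(1) PB(5) by (auto simp: PiE_iff)
    then show "f \<in> hom_set scale scale A (sum_sets P B)" using f(3,4) by (intro hom_setI)
    show "direct_summand scale {x \<in> A. f x = 0} A" by (rule d(3))
    have "f ` A \<subseteq> B" using f(2) by blast
    then show "\<not> direct_summand scale (f ` A) (sum_sets P B)"
      using d(4) direct_summand_restrict[OF _ AB(2) _ PB(5)] by blast
  qed
  then show ?thesis by (simp add: \<delta>_eq lift_defect_codomain_def)
qed

lemma torsion_sum_sets: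
  assumes PT: "direct_sum scale UNIV P (torsion scale UNIV)" and A: "subspace A" "A \<subseteq> torsion scale UNIV"
  shows "torsion scale (sum_sets P A) = A"
proof (intro equalityI subsetI)
  note P = direct_sumD[OF PT] and PA = direct_sumD[OF direct_sum_sub[OF PT A]]
  {
    fix x assume "x \<in> torsion scale (sum_sets P A)"
    then have x: "x \<in> sum_sets P A" "x \<in> torsion scale UNIV" by (auto simp: torsion_def)
    then obtain p a where pa: "p \<in> P" "a \<in> A" "x = p + a" by (auto elim!: sum_setsE)
    then have "p = x - a" by simp
    also have "\<dots> \<in> torsion scale UNIV" using x(2) pa(2) A(2) P(2) by (intro subspace_diff) auto
    finally have "p = 0" using pa(1) P(7) by blast
    then show "x \<in> A" using pa by simp
  next
    fix x assume "x \<in> A"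
    then show "x \<in> torsion scale (sum_sets P A)" using PA(5) A(2) by (subst torsion_eq_Int) blast
  }
qed

text \<open>The very same triple returns, because homomorphisms are \<open>undefined\<close> outside
  their domain and \<open>P\<close> contributes no torsion.\<close>

lemma reduce_lift_defect:
  assumes PT: "direct_sum scale UNIV P (torsion scale UNIV)"
    and \<delta>: "\<delta> \<in> C4_defects scale (torsion scale UNIV)"
  shows "reduce_defect scale (lift_defect_domain P \<delta>) = \<delta>"
    and "reduce_defect scale (lift_defect_codomain P \<delta>) = \<delta>"
proof -
  obtain A B f where \<delta>_eq: "\<delta> = (A, B, f)" by (cases \<delta>) auto
  note d = C4_defectsD[OF \<delta>[unfolded \<delta>_eq]]
  note AB = direct_sumD[OF d(1)] and f = hom_setD[OF d(2)]
  note P0 = subspace_0[OF direct_sumD(1)[OF PT]]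
  have A: "torsion scale A = A" and B: "torsion scale B = B"
    using AB(4,5) by (subst torsion_eq_Int; blast)+
  have fA: "restrict f A = f" using f(1) by (auto simp: PiE_def extensional_restrict)
  define g where "g = (\<lambda>x \<in> sum_sets P A. f (THE a. a \<in> A \<and> x - a \<in> P))"
  have "g a = f a" if "a \<in> A" for a
    using lift_defect_domain_apply[OF PT AB(1,4) P0 that, of f] by (simp add: g_def)
  then have "restrict g A = restrict f A" by (rule restrict_ext)
  then show "reduce_defect scale (lift_defect_domain P \<delta>) = \<delta>"
    by (simp add: \<delta>_eq reduce_defect_def lift_defect_domain_def torsion_sum_sets[OF PT AB(1,4)] B fA flip: g_def)
  show "reduce_defect scale (lift_defect_codomain P \<delta>) = \<delta>"
    by (simp add: \<delta>_eq reduce_defect_def lift_defect_codomain_def torsion_sum_sets[OF PT AB(2,5)] A fA)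
qed

section \<open>Reducing defects to the torsion submodule\<close>

text \<open>If \<open>d\<close> annihilates \<open>a + b\<close>, then
  \<open>d *s a = - (d *s b)\<close> lies in \<open>A \<inter> B = {0}\<close>, so both components
  are torsion.\<close>

lemma direct_sum_torsion:
  assumes "direct_sum scale X A B"
  shows "direct_sum scale (torsion scale X) (torsion scale A) (torsion scale B)"
proof (rule direct_sumI)
  note AB = direct_sumD[OF assms]
  show "subspace (torsion scale A)" "subspace (torsion scale B)" "subspace (torsion scale X)"
    using AB(1-3) by (simp_all add: subspace_torsion)
  show "torsion scale A \<subseteq> torsion scale X" "torsion scale B \<subseteq> torsion scale X"
    using AB(4,5) by (auto simp: torsion_def)
  show "x = 0" if "x \<in> torsion scale A" "x \<in> torsion scale B" for x
    using that AB(7) by (auto simp: torsion_def)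
  fix x assume "x \<in> torsion scale X"
  then obtain d where x: "x \<in> X" "d \<noteq> 0" "d *s x = 0" by (auto simp: torsion_def)
  then obtain a b where ab: "a \<in> A" "b \<in> B" "x = a + b" using AB(6) by (auto elim: sum_setsE)
  then have eq: "d *s a = - (d *s b)" using x(3) by (simp add: scale_right_distrib eq_neg_iff_add_eq_0)
  have "d *s a \<in> A" using ab AB(1) by (simp add: subspace_scale)
  moreover have "d *s a \<in> B" unfolding eq using ab AB(2) by (intro subspace_neg subspace_scale)
  ultimately have "d *s a = 0" using AB(7) by blast
  then have "d *s a = 0" "d *s b = 0" using eq by auto
  then have "a \<in> torsion scale A" "b \<in> torsion scale B" using ab x(2) by (auto simp: torsion_def)
  then show "\<exists>a\<in>torsion scale A. \<exists>b\<in>torsion scale B. x = a + b" using ab(3) by blast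
qed

text \<open>In rank at most one, a complement \<open>C\<close> of \<open>ker f\<close> is torsion, since for a nontorsion \<open>c \<in> C\<close> the
  elements \<open>c\<close> and \<open>f c\<close> would be independent. Hence \<open>f\<close> and its restriction to torsion have the same
  image.\<close>

lemma reduce_defect_C4:
  assumes PT: "direct_sum scale UNIV P (torsion scale UNIV)"
    and rank: "\<nexists>x y. independent_pair x y"
    and \<delta>: "\<delta> \<in> C4_defects scale UNIV"
  shows "reduce_defect scale \<delta> \<in> C4_defects scale (torsion scale UNIV)"
proof -
  obtain A B f where \<delta>_eq: "\<delta> = (A, B, f)" by (cases \<delta>) auto
  note d = C4_defectsD[OF \<delta>[unfolded \<delta>_eq]]
  note AB = direct_sumD[OF d(1)] and f = hom_setD[OF d(2)]
  note f0 = hom_set_zero[OF d(2) AB(1)]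
  let ?T = "torsion scale"
  let ?K = "{x \<in> A. f x = 0}"
  let ?g = "restrict f (?T A)"
  note TAB = direct_sum_torsion[OF d(1)]
  obtain C where C: "direct_sum scale A ?K C" using d(3) by (auto simp: direct_summand_def)
  note KC = direct_sumD[OF C]
  have TA: "?T A \<subseteq> A" by (auto simp: torsion_def)
  have "(?T A, ?T B, ?g) \<in> C4_defects scale (?T UNIV)"
  proof (rule C4_defectsI)
    show "direct_sum scale (?T UNIV) (?T A) (?T B)" by (rule TAB)
    note STA = direct_sumD(1)[OF TAB]
    have fT: "f x \<in> ?T B" if x: "x \<in> ?T A" for x
    proof -
      obtain c where c: "x \<in> A" "c \<noteq> 0" "c *s x = 0" using x unfolding torsion_def by blast
      then have "c *s f x = 0" using f(4)[of x c] f0 by simp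
      then show ?thesis using c f(2) by (auto simp: torsion_def)
    qed
    show "?g \<in> hom_set scale scale (?T A) (?T B)"
    proof (rule hom_setI)
      show "?g \<in> ?T A \<rightarrow>\<^sub>E ?T B" using fT by auto
      show "?g (x + y) = ?g x + ?g y" if "x \<in> ?T A" "y \<in> ?T A" for x y
        using that subspace_add[OF STA] f(3) TA by (simp add: subset_iff)
      show "?g (c *s x) = c *s ?g x" if "x \<in> ?T A" for c x
        using that subspace_scale[OF STA] f(4) TA by (simp add: subset_iff)
    qed
    have "{x \<in> ?T A. ?g x = 0} = ?T ?K" by (auto simp: torsion_def)
    then show "direct_summand scale {x \<in> ?T A. ?g x = 0} (?T A)"
      unfolding direct_summand_def using direct_sum_torsion[OF C] by auto
    have C_torsion: "c \<in> ?T A" if c: "c \<in> C" for c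
    proof (rule ccontr)
      assume nt: "c \<notin> ?T A"
      have cA: "c \<in> A" using c KC(5) by blast
      \<comment> \<open>A relation puts \<open>a *s c = - (b *s f c)\<close> in
        \<open>A \<inter> B\<close>, so both sides vanish. Then \<open>b *s c\<close> lies in
        \<open>ker f \<inter> C\<close> and vanishes too, and \<open>c\<close> is
        nontorsion.\<close>
      have "independent_pair c (f c)"
        unfolding independent_pair_def
      proof (intro allI impI)
        fix a b assume ab: "a *s c + b *s f c = 0"
        then have eq: "a *s c = - (b *s f c)" by (simp add: eq_neg_iff_add_eq_0)
        have "a *s c \<in> A" using cA AB(1) by (simp add: subspace_scale)
        moreover have "a *s c \<in> B" unfolding eq using f(2)[OF cA] AB(2) by (intro subspace_neg subspace_scale)
        ultimately have ac: "a *s c = 0" using AB(7) by blast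
        then have "f (b *s c) = 0" using eq f(4)[OF cA] by simp
        then have "b *s c \<in> ?K" using cA AB(1) by (simp add: subspace_scale)
        moreover have "b *s c \<in> C" using c KC(2) by (simp add: subspace_scale)
        ultimately have "b *s c = 0" using KC(7) by blast
        then show "a = 0 \<and> b = 0" using ac nt cA by (auto simp: torsion_def)
      qed
      then show False using rank by blast
    qed
    have image: "?g ` ?T A = f ` A"
    proof (intro equalityI subsetI)
      fix y assume "y \<in> f ` A"
      then obtain x where x: "x \<in> A" "y = f x" by blast
      have "x \<in> sum_sets ?K C" using x(1) KC(6) by blast
      then obtain k c where "k \<in> ?K" and c: "c \<in> C" "x = k + c" by (rule sum_setsE)
      then have kc: "k \<in> A" "f k = 0" "c \<in> C" "x = k + c" by simp_all
      then have "y = f c" using x f(3)[of k c] KC(5) by auto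
      then show "y \<in> ?g ` ?T A" using C_torsion[OF kc(3)] by auto
    qed (use TA in auto)
    show "\<not> direct_summand scale (?g ` ?T A) (?T B)"
      unfolding image
    proof
      \<comment> \<open>The torsion of \<open>B\<close> is a summand of the torsion submodule, which
        \<open>P\<close> complements; so it is a summand of the whole module and, by restriction, of
        \<open>B\<close>.\<close>
      assume fA: "direct_summand scale (f ` A) (?T B)"
      have "direct_summand scale (?T B) (?T UNIV)" "direct_summand scale (?T UNIV) UNIV"
        unfolding direct_summand_def using direct_sum_commute[OF TAB] direct_sum_commute[OF PT] by blast+
      then have "direct_summand scale (?T B) UNIV" by (rule direct_summand_trans)
      then have "direct_summand scale (?T B) B"
        by (rule direct_summand_restrict) (auto simp: AB(2) torsion_def)
      with fA have "direct_summand scale (f ` A) B" by (rule direct_summand_trans)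
      then show False using d(4) by simp
    qed
  qed
  then show ?thesis by (simp add: \<delta>_eq reduce_defect_def)
qed

section \<open>The defect in rank at least two\<close>

text \<open>The complement \<open>C\<close> of \<open>J\<close> contains \<open>T\<close>, so
  \<open>C/T\<close> is a complement of \<open>(J + T)/T\<close>.\<close>

lemma quotient_direct_summand_sum_sets:
  assumes X: "direct_sum scale X J C" and T: "subspace T" "T \<subseteq> C"
  shows "quotient_direct_summand scale T (sum_sets J T) X"
  unfolding quotient_direct_summand_def
proof (intro conjI exI[of _ C])
  note JC = direct_sumD[OF X]
  show "subspace (sum_sets J T)" "subspace C" "T \<subseteq> C" using JC T by (simp_all add: subspace_sum_sets)
  show TJ: "T \<subseteq> sum_sets J T" using sum_setsI[OF subspace_0[OF JC(1)]] by force
  show "X = sum_sets (sum_sets J T) C"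
  proof (intro equalityI subsetI)
    fix x assume "x \<in> X"
    then obtain j c where jc: "j \<in> J" "c \<in> C" "x = j + c" using JC(6) by (auto elim: sum_setsE)
    have "j + 0 \<in> sum_sets J T" using jc(1) subspace_0[OF T(1)] by (rule sum_setsI)
    then show "x \<in> sum_sets (sum_sets J T) C" using sum_setsI[of "j + 0" _ c] jc by simp
  next
    fix x assume "x \<in> sum_sets (sum_sets J T) C"
    then obtain j t c where "j \<in> J" "t \<in> T" "c \<in> C" "x = (j + t) + c" by (auto elim!: sum_setsE)
    then show "x \<in> X" using JC(4,5) T(2) by (auto intro!: subspace_add[OF JC(3)])
  qed
  show "sum_sets J T \<inter> C = T"
  proof (intro equalityI subsetI)
    fix x assume x: "x \<in> sum_sets J T \<inter> C"
    then obtain j t where jt: "j \<in> J" "t \<in> T" "x = j + t" by (auto elim!: sum_setsE)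
    then have "j = x - t" by simp
    also have "\<dots> \<in> C" using x jt(2) T(2) by (intro subspace_diff[OF JC(2)]) auto
    finally have "j = 0" using jt(1) JC(7) by blast
    then show "x \<in> T" using jt by simp
  qed (use TJ T(2) in blast)
qed

text \<open>\<open>\<chi>\<close> allows cancelling \<open>x\<close>, so \<open>span {x}\<close> is
  a copy of \<open>D\<close>. If a complement existed, writing \<open>x = u + c\<close> would put
  \<open>q *s c\<close> in both summands; hence \<open>q *s x = q *s u\<close> with
  \<open>u = k *s q *s x\<close>, and cancelling makes \<open>q\<close> a unit.\<close>

lemma span_singleton_not_summand:
  assumes \<chi>: "functional \<chi>" "\<chi> x \<noteq> 0" and q: "q \<noteq> 0" "\<nexists>k. q * k = 1" and x: "x \<in> B"
  shows "x \<notin> span {q *s x}" and "\<not> direct_summand scale (span {q *s x}) B"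
proof -
  interpret \<chi>: module_hom scale "(*)" \<chi> by fact
  have cancel: "a = b" if "a *s x = b *s x" for a b
  proof -
    have "a * \<chi> x = b * \<chi> x" using arg_cong[OF that, of \<chi>] by (simp only: \<chi>.scale)
    then show ?thesis using \<chi>(2) by simp
  qed
  show "x \<notin> span {q *s x}"
  proof
    assume "x \<in> span {q *s x}"
    then obtain k where "1 *s x = (q * k) *s x" by (auto simp: span_singleton mult.commute)
    then have "1 = q * k" by (rule cancel)
    then show False using q(2) by metis
  qed
  show "\<not> direct_summand scale (span {q *s x}) B"
  proof
    assume "direct_summand scale (span {q *s x}) B"
    then obtain C where "direct_sum scale B (span {q *s x}) C" by (auto simp: direct_summand_def)
    note D = direct_sumD[OF this]
    obtain u c where uc: "u \<in> span {q *s x}" "c \<in> C" "x = u + c" using x D(6) by (auto elim: sum_setsE)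
    have "q *s x = q *s u + q *s c" by (subst uc(3)) (rule scale_right_distrib)
    then have "q *s c = q *s x - q *s u" by simp
    also have "\<dots> \<in> span {q *s x}" by (rule span_diff[OF span_base span_scale[OF uc(1)]]) simp
    finally have "q *s c \<in> span {q *s x}" .
    moreover have "q *s c \<in> C" using uc(2) D(2) by (simp add: subspace_scale)
    ultimately have qc: "q *s c = 0" using D(7) by blast
    obtain k where u: "u = k *s q *s x" using uc(1) by (auto simp: span_singleton)
    have "q *s x = q *s u" using \<open>q *s x = q *s u + q *s c\<close> qc by simp
    then have "q *s x = (q * (k * q)) *s x" by (simp add: u mult.assoc)
    then have "q = q * (k * q)" by (rule cancel)
    then have "q * k = 1" using q(1) by (simp add: mult.commute)
    then show False using q(2) by blast
  qed
qed

lemma C4_defect_rank_ge_2: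
  assumes ded: "dedekind_domain TYPE('a)" and not_field: "\<not> is_field TYPE('a)"
    and fg: "finitely_generated scale" and xy: "independent_pair x y"
  shows "\<exists>A B f. (A, B, f) \<in> C4_defects scale UNIV \<and> free_of_rank_one scale A \<and>
    (\<exists>J I x. subspace J \<and> J \<subseteq> B \<and> J \<inter> torsion scale UNIV = {0} \<and>
      quotient_direct_summand scale (torsion scale UNIV) (sum_sets J (torsion scale UNIV)) UNIV \<and>
      invertible_ideal I \<and> isomorphic scale (*) J I \<and>
      x \<noteq> 0 \<and> f ` A = span {x} \<and> f ` A \<subset> J)"
proof -
  let ?T = "torsion scale UNIV"
  obtain \<psi> e where \<psi>: "functional \<psi>" and e: "\<psi> e = 1" by (rule unimodular_functional[OF ded fg xy])
  \<comment> \<open>The second independent direction leaves a nontorsion \<open>z\<close> in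
    \<open>ker \<psi>\<close>, and hence a functional \<open>\<chi>\<close> that is nonzero there
    and along which \<open>B\<close> splits.\<close>
  obtain z where z: "\<psi> z = 0" "z \<notin> ?T" by (rule independent_pair_kernel[OF xy \<psi>])
  obtain \<chi> where \<chi>: "functional \<chi>" and \<chi>z: "\<chi> z \<noteq> 0" by (rule nontorsion_functional[OF fg z(2)])
  interpret \<psi>: module_hom scale "(*)" \<psi> by fact
  interpret \<chi>: module_hom scale "(*)" \<chi> by fact
  define A where "A = span {e}"
  define B where "B = {m. \<psi> m = 0}"
  define N where "N = {m \<in> B. \<chi> m = 0}"
  have A_eq: "A = range (\<lambda>k. k *s e)" by (simp add: A_def span_singleton)
  have B: "subspace B" unfolding B_def by (rule \<psi>.subspace_kernel)
  have AB: "direct_sum scale UNIV A B"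
  proof (rule direct_sumI)
    show "\<exists>a\<in>A. \<exists>b\<in>B. m = a + b" for m
    proof (intro bexI)
      show "m = \<psi> m *s e + (m - \<psi> m *s e)" by simp
      show "m - \<psi> m *s e \<in> B" by (simp add: B_def \<psi>.diff \<psi>.scale e)
      show "\<psi> m *s e \<in> A" by (simp add: A_eq)
    qed
    show "m = 0" if "m \<in> A" "m \<in> B" for m
      using that by (auto simp: A_eq B_def \<psi>.scale e)
  qed (simp_all add: A_def B)
  obtain J where BJ: "direct_sum scale B J N" and J: "\<chi> ` J = \<chi> ` B" "inj_on \<chi> J"
    unfolding N_def by (rule functional_splits[OF ded \<chi> B])
  note BJD = direct_sumD[OF BJ]
  have "\<chi> z \<in> \<chi> ` J" using z(1) by (simp add: J(1) B_def)
  then obtain w where w: "w \<in> J" "\<chi> w \<noteq> 0" using \<chi>z by auto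
  have wB: "w \<in> B" using w(1) BJD(4) by blast
  obtain q :: 'a where q: "q \<noteq> 0" "\<nexists>k. q * k = 1" using not_field by (auto simp: is_field_def)
  \<comment> \<open>The factor \<open>q\<close> makes the image proper in \<open>J\<close> even when
    \<open>w\<close> generates \<open>J\<close>, and keeps it from being a summand even when
    \<open>span {w}\<close> is one.\<close>
  define v where "v = q *s w"
  have \<chi>v: "\<chi> v \<noteq> 0" using q(1) w(2) by (simp add: v_def \<chi>.scale)
  then have v0: "v \<noteq> 0" using \<chi>.zero by auto
  have vJ: "v \<in> J" unfolding v_def using BJD(1) w(1) by (rule subspace_scale)
  have not_summand: "w \<notin> span {v}" "\<not> direct_summand scale (span {v}) B"
    unfolding v_def using span_singleton_not_summand[OF \<chi> w(2) q wB] by simp_all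
  define f where "f = (\<lambda>m\<in>A. \<psi> m *s v)"
  have f_e: "f (k *s e) = k *s v" for k by (simp add: f_def A_eq \<psi>.scale e)
  have image: "f ` A = span {v}"
    unfolding A_eq span_singleton image_image by (simp only: f_e)
  have A: "subspace A" by (simp add: A_def)
  have defect: "(A, B, f) \<in> C4_defects scale UNIV"
  proof (rule C4_defectsI[OF AB])
    show "f \<in> hom_set scale scale A B"
    proof (rule hom_setI)
      have "k *s v \<in> B" for k using vJ BJD(4) B by (auto intro: subspace_scale)
      then show "f \<in> A \<rightarrow>\<^sub>E B" by (auto simp: f_def)
      show "f (m + n) = f m + f n" if "m \<in> A" "n \<in> A" for m n
        using that subspace_add[OF A that] by (simp add: f_def \<psi>.add scale_left_distrib)
      show "f (d *s m) = d *s f m" if "m \<in> A" for d m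
        using that subspace_scale[OF A that] by (simp add: f_def \<psi>.scale)
    qed
    have "m = 0" if m: "m \<in> A" "f m = 0" for m
    proof -
      obtain k where k: "m = k *s e" using m(1) by (auto simp: A_eq)
      then have "k *s v = 0" using m(2) by (simp only: f_e)
      then have "k * \<chi> v = 0" using \<chi>.scale[of k v] \<chi>.zero by simp
      then show ?thesis using \<chi>v k by simp
    qed
    moreover have "f 0 = 0" using f_e[of 0] by simp
    ultimately have "{m \<in> A. f m = 0} = {0}" using subspace_0[OF A] by auto
    moreover have "direct_sum scale A {0} A" by (rule direct_sumI) (use A subspace_0[OF A] in auto)
    ultimately show "direct_summand scale {m \<in> A. f m = 0} A" by (auto simp: direct_summand_def)
    show "\<not> direct_summand scale (f ` A) B" unfolding image by (rule not_summand(2))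
  qed
  have "independent {e}"
    unfolding dependent_finite[OF finite.insertI[OF finite.emptyI]]
  proof clarsimp
    fix u assume "u e *s e = 0" "u e \<noteq> 0"
    then show False using \<psi>.scale[of "u e" e] \<psi>.zero e by simp
  qed
  then have free: "free_of_rank_one scale A" unfolding free_of_rank_one_def A_def by blast
  have J_T: "J \<inter> ?T = {0}"
  proof -
    have "t = 0" if "t \<in> J" "t \<in> ?T" for t
      using inj_onD[OF J(2), of t 0] that functional_torsion[OF \<chi> that(2)] subspace_0[OF BJD(1)] \<chi>.zero by simp
    then show ?thesis using subspace_0[OF BJD(1)] subspace_0[OF subspace_torsion[OF subspace_UNIV]] by blast
  qed
  \<comment> \<open>This complement of \<open>J\<close> contains the torsion, which lies in
    \<open>N\<close> because \<open>\<psi>\<close> and \<open>\<chi>\<close> vanish on it.\<close>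
  have "direct_sum scale UNIV J (sum_sets A N)"
    by (rule direct_sum_commute[OF direct_sum_assoc[OF AB direct_sum_commute[OF BJ]]])
  moreover have "?T \<subseteq> sum_sets A N"
  proof
    fix t assume "t \<in> ?T"
    then have "t \<in> N" using functional_torsion[OF \<psi>] functional_torsion[OF \<chi>] by (simp add: N_def B_def)
    then show "t \<in> sum_sets A N" using sum_setsI[OF subspace_0[OF A], of t N] by simp
  qed
  ultimately have quot: "quotient_direct_summand scale ?T (sum_sets J ?T) UNIV"
    by (rule quotient_direct_summand_sum_sets[OF _ subspace_torsion[OF subspace_UNIV]])
  have "is_ideal (\<chi> ` J)" by (rule \<chi>.subspace_image[OF BJD(1)])
  moreover have "\<chi> ` J \<noteq> {0}" using w by blast
  ultimately have inv: "invertible_ideal (\<chi> ` J)" by (rule dedekind_invertible[OF ded])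
  have "restrict \<chi> J \<in> hom_set scale (*) J (\<chi> ` J)"
    by (rule hom_setI)
      (use subspace_add[OF BJD(1)] subspace_scale[OF BJD(1)] in \<open>auto simp: \<chi>.add \<chi>.scale\<close>)
  moreover have "bij_betw (restrict \<chi> J) J (\<chi> ` J)" using J(2) by (simp add: bij_betw_def)
  ultimately have iso: "isomorphic scale (*) J (\<chi> ` J)" unfolding isomorphic_def by blast
  have "span {v} \<subseteq> J" using vJ BJD(1) by (intro span_minimal) auto
  then have proper: "f ` A \<subset> J" unfolding image using not_summand(1) w(1) by blast
  show ?thesis
    by (intro exI conjI) (rule defect free BJD(1,4) J_T quot inv iso v0 image proper)+
qed

end

theorem theorem10p2:
  fixes s :: "'a::idom \<Rightarrow> 'b::ab_group_add \<Rightarrow> 'b"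
    and M T :: "'b set" and r :: nat
  assumes dedekind: "dedekind_domain TYPE('a)"
    and not_field: "\<not> is_field TYPE('a)"
    and mod: "module s"
    and fg: "finitely_generated s"
    and M_def: "M = UNIV"
    and T_def: "T = torsion s M"
    and r_def: "r = module_rank s"
  shows
    "(r \<le> 1 \<longrightarrow>
        (\<exists>P. direct_sum s M P T) \<and>
        (\<forall>P. direct_sum s M P T \<longrightarrow> (\<forall>\<delta> \<in> C4_defects s T.
           lift_defect_domain P \<delta> \<in> C4_defects s M \<and>
           reduce_defect s (lift_defect_domain P \<delta>) = \<delta> \<and>
           lift_defect_codomain P \<delta> \<in> C4_defects s M \<and>
           reduce_defect s (lift_defect_codomain P \<delta>) = \<delta>)) \<and>
        (\<forall>\<delta> \<in> C4_defects s M. reduce_defect s \<delta> \<in> C4_defects s T))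
     \<and> (r \<ge> 2 \<longrightarrow>
        (\<exists>A B f. (A, B, f) \<in> C4_defects s M \<and> free_of_rank_one s A \<and>
           (\<exists>J I x. module.subspace s J \<and> J \<subseteq> B \<and> J \<inter> T = {0} \<and>
              quotient_direct_summand s T (sum_sets J T) M \<and>
              invertible_ideal I \<and> isomorphic s (*) J I \<and>
              x \<noteq> 0 \<and> f ` A = module.span s {x} \<and> f ` A \<subset> J)))
     \<and> (C4_defects s M = {} \<longleftrightarrow> r \<le> 1 \<and> C4_defects s T = {})"
    (is "(_ \<longrightarrow> ?i) \<and> (_ \<longrightarrow> ?ii) \<and> ?iff")
proof -
  interpret idom_module s by (rule idom_module.intro[OF mod])
  have T: "T = torsion s UNIV" by (simp add: T_def M_def)
  obtain P where P: "direct_sum s M P T"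
    using torsion_direct_sum[OF dedekind fg] unfolding M_def T by blast
  have rank: "2 \<le> r \<longleftrightarrow> (\<exists>x y. independent_pair x y)"
    unfolding r_def by (rule module_rank_ge_2_iff[OF fg])
  have lift: "lift_defect_domain P \<delta> \<in> C4_defects s M \<and> reduce_defect s (lift_defect_domain P \<delta>) = \<delta> \<and>
      lift_defect_codomain P \<delta> \<in> C4_defects s M \<and> reduce_defect s (lift_defect_codomain P \<delta>) = \<delta>"
    if "direct_sum s M P T" "\<delta> \<in> C4_defects s T" for P \<delta>
    using that lift_defect_domain_C4 lift_defect_codomain_C4 reduce_lift_defect unfolding M_def T by simp
  \<comment> \<open>Here \<open>r \<le> 1\<close> enters, as the absence of an independent
    pair.\<close>
  have reduce: "reduce_defect s \<delta> \<in> C4_defects s T" if "r \<le> 1" "\<delta> \<in> C4_defects s M" for \<delta>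
  proof -
    have "\<nexists>x y. independent_pair x y" using that(1) rank by simp
    then show ?thesis using P that(2) reduce_defect_C4 unfolding M_def T by simp
  qed
  have ge_2: ?ii if r: "r \<ge> 2"
  proof -
    obtain x y where "independent_pair x y" using r rank by blast
    from C4_defect_rank_ge_2[OF dedekind not_field fg this] show ?thesis unfolding M_def T .
  qed
  have ?iff
  proof
    assume none: "C4_defects s M = {}"
    have "r \<le> 1"
    proof (rule ccontr)
      assume "\<not> r \<le> 1"
      then have ?ii using ge_2 by simp
      then show False using none by blast
    qed
    moreover have "\<delta> \<notin> C4_defects s T" for \<delta> using lift[OF P, of \<delta>] none by auto
    ultimately show "r \<le> 1 \<and> C4_defects s T = {}" by blast
  next
    assume "r \<le> 1 \<and> C4_defects s T = {}"
    then show "C4_defects s M = {}" using reduce by blast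
  qed
  moreover have ?i if "r \<le> 1" using P lift reduce[OF that] by blast
  ultimately show ?thesis using ge_2 by blast
qed

end
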